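(* Equip $\mathcal{X}$ either with the box topology or with the concentration topology. Then $\mathcal{X}_* = \mathcal{X}\setminus\{*\}$ is not homeomorphic to $\mathbb{R}_+\times\Sigma$, and $\mathcal{X}$ is not homeomorphic to the cone over $\Sigma$, where $\Sigma=\mathcal{X}_*/\mathbb{R}_+$ carries the quotient topology.
   Context: An mm-space is a triple $(X,d_X,\mu_X)$ where $(X,d_X)$ is a complete separable metric space and $\mu_X$ is a Borel probability measure on $X$. Two mm-spaces $X,Y$ are mm-isomorphic if there is an isometry $f\colon \operatorname{supp}\mu_X\to\operatorname{supp}\mu_Y$ with $f_*\mu_X=\mu_Y$. $\mathcal{X}$ is the set of mm-isomorphism classes of mm-spaces, and every mm-space is assumed to satisfy $X=\operatorname{supp}\mu_X$. Let $I=[0,1)$ with Lebesgue measure $\mathcal{L}^1$. A parameter of $X$ is a Borel map $\varphi\colon I\to X$ with $\varphi_*\mathcal{L}^1=\mu_X$. The box distance $\square(X,Y)$ is the infimum of $\varepsilon\ge0$ such that there exist parameters $\varphi$ of $X$, $\psi$ of $Y$ and a Borel set $I_0\subset I$ with $\mathcal{L}^1(I_0)\ge 1-\varepsilon$ and $|d_X(\varphi(s),\varphi(t))-d_Y(\psi(s),\psi(t))|\le\varepsilon$ for all $s,t\in I_0$. It is a metric on $\mathcal{X}$, and the box topology is the topology it induces. For measurable $f,g\colon I\to\mathbb{R}$, the Ky Fan metric is $d_{KF}(f,g)=\inf\{\varepsilon\ge0 : \mathcal{L}^1(\{|f-g|>\varepsilon\})\le\varepsilon\}$. The observable distance is $d_{\mathrm{conc}}(X,Y)=\inf_{\varphi,\psi}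 d_H(\{f\circ\varphi : f\colon X\to\mathbb{R}\text{ 1-Lipschitz}\},\{g\circ\psi : g\colon Y\to\mathbb{R}\text{ 1-Lipschitz}\})$, where $\varphi,\psi$ range over parameters of $X,Y$ and $d_H$ is the Hausdorff distance with respect to $d_{KF}$. It is a metric on $\mathcal{X}$, and the concentration topology is the topology it induces. The multiplicative group $\mathbb{R}_+=(0,\infty)$ acts on $\mathcal{X}$ by $tX=(X,t\,d_X,\mu_X)$. The one-point mm-space $*$ is its only fixed point. Set $\mathcal{X}_*=\mathcal{X}\setminus\{*\}$ and $\Sigma=\mathcal{X}_*/\mathbb{R}_+$ with the quotient topology. The cone over $\Sigma$ is $(\Sigma\times[0,\infty))/(\Sigma\times\{0\})$. *)

theory Defs
  imports "HOL-Analysis.Analysis" "HOL-Probability.Probability"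
begin

text \<open>Every complete separable metric space has cardinality at most the continuum, so every
mm-space is mm-isomorphic to one whose underlying set is a subset of the type real.
An mm-space is represented as a triple (S, d, mu): S the underlying set, d the metric on S,
mu a Borel probability measure on (S, d) (space mu = S, sets mu = Borel sets of the metric
topology).  We assume (as in the paper) that S = supp mu.\<close>

type_synonym mm = "real set \<times> (real \<Rightarrow> real \<Rightarrow> real) \<times> real measure"

definition mm_set :: "mm \<Rightarrow> real set" where "mm_set X = fst X"
definition mm_dist :: "mm \<Rightarrow> real \<Rightarrow> real \<Rightarrow> real" where "mm_dist X = fst (snd X)"
definition mm_meas :: "mm \<Rightarrow> real measure" where "mm_meas X = snd (snd X)"

definition mm_top :: "mm \<Rightarrow> real topology" where
  "mm_top X = Metric_space.mtopology (mm_set X) (mm_dist X)"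

definition borel_sets_of :: "'a topology \<Rightarrow> 'a set set" where
  "borel_sets_of T = sigma_sets (topspace T) {U. openin T U}"

definition mm_space :: "mm \<Rightarrow> bool" where
  "mm_space X \<longleftrightarrow>
     Metric_space (mm_set X) (mm_dist X)
   \<and> Metric_space.mcomplete (mm_set X) (mm_dist X)
   \<and> separable_space (mm_top X)
   \<and> prob_space (mm_meas X)
   \<and> space (mm_meas X) = mm_set X
   \<and> sets (mm_meas X) = borel_sets_of (mm_top X)
   \<and> (\<forall>x\<in>mm_set X. \<forall>U. openin (mm_top X) U \<and> x \<in> U \<longrightarrow> emeasure (mm_meas X) U > 0)"

text \<open>mm-isomorphism (supports are the whole spaces): a measure-preserving isometric bijection.\<close>
definition mm_iso :: "mm \<Rightarrow> mm \<Rightarrow> bool" where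
  "mm_iso X Y \<longleftrightarrow> (\<exists>f. bij_betw f (mm_set X) (mm_set Y)
      \<and> (\<forall>x\<in>mm_set X. \<forall>y\<in>mm_set X. mm_dist Y (f x) (f y) = mm_dist X x y)
      \<and> f \<in> measurable (mm_meas X) (mm_meas Y)
      \<and> distr (mm_meas X) (mm_meas Y) f = mm_meas Y)"

definition mm_class :: "mm \<Rightarrow> mm set" where
  "mm_class X = {Y. mm_space Y \<and> mm_iso X Y}"

definition XX :: "mm set set" where
  "XX = {mm_class X | X. mm_space X}"

definition mm_rep :: "mm set \<Rightarrow> mm" where
  "mm_rep A = (SOME X. X \<in> A)"

definition mm_point :: mm where
  "mm_point = ({0}, (\<lambda>x y. 0), return (count_space {0}) 0)"

definition star :: "mm set" where
  "star = mm_class mm_point"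

definition XX_star :: "mm set set" where
  "XX_star = XX - {star}"

definition LI :: "real measure" where
  "LI = restrict_space lborel {0..<1}"

definition parameter :: "mm \<Rightarrow> (real \<Rightarrow> real) \<Rightarrow> bool" where
  "parameter X \<phi> \<longleftrightarrow> \<phi> \<in> measurable LI (mm_meas X) \<and> distr LI (mm_meas X) \<phi> = mm_meas X"

definition box_dist :: "mm \<Rightarrow> mm \<Rightarrow> real" where
  "box_dist X Y = Inf {\<epsilon>. 0 \<le> \<epsilon> \<and> (\<exists>\<phi> \<psi> I0. parameter X \<phi> \<and> parameter Y \<psi> \<and> I0 \<in> sets LI
      \<and> measure LI I0 \<ge> 1 - \<epsilon>
      \<and> (\<forall>s\<in>I0. \<forall>t\<in>I0. \<bar>mm_dist X (\<phi> s) (\<phi> t) - mm_dist Y (\<psi> s) (\<psi> t)\<bar> \<le> \<epsilon>))}"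

definition ky_fan :: "(real \<Rightarrow> real) \<Rightarrow> (real \<Rightarrow> real) \<Rightarrow> real" where
  "ky_fan f g = Inf {\<epsilon>. 0 \<le> \<epsilon> \<and> measure LI {s \<in> {0..<1}. \<bar>f s - g s\<bar> > \<epsilon>} \<le> \<epsilon>}"

definition hausdorff_kf :: "(real \<Rightarrow> real) set \<Rightarrow> (real \<Rightarrow> real) set \<Rightarrow> real" where
  "hausdorff_kf A B = max (SUP f\<in>A. INF g\<in>B. ky_fan f g) (SUP g\<in>B. INF f\<in>A. ky_fan f g)"

definition lip1 :: "mm \<Rightarrow> (real \<Rightarrow> real) set" where
  "lip1 X = {f. \<forall>x\<in>mm_set X. \<forall>y\<in>mm_set X. \<bar>f x - f y\<bar> \<le> mm_dist X x y}"

definition conc :: "mm \<Rightarrow> mm \<Rightarrow> real" where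
  "conc X Y = Inf {hausdorff_kf ((\<lambda>f. f \<circ> \<phi>) ` lip1 X) ((\<lambda>g. g \<circ> \<psi>) ` lip1 Y) | \<phi> \<psi>.
                     parameter X \<phi> \<and> parameter Y \<psi>}"

definition dist_topology :: "'a set \<Rightarrow> ('a \<Rightarrow> 'a \<Rightarrow> real) \<Rightarrow> 'a topology" where
  "dist_topology M \<delta> = topology (\<lambda>U. U \<subseteq> M \<and> (\<forall>x\<in>U. \<exists>e>0. {y\<in>M. \<delta> x y < e} \<subseteq> U))"

text \<open>Topology on the set of isomorphism classes induced by a distance on mm-spaces
(box_dist or conc); both are invariant under mm-isomorphism, so representatives may be used.\<close>
definition XX_top :: "(mm \<Rightarrow> mm \<Rightarrow> real) \<Rightarrow> mm set topology" where
  "XX_top \<delta> = dist_topology XX (\<lambda>A B. \<delta> (mm_rep A) (mm_rep B))"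

definition quotient_topology :: "'a topology \<Rightarrow> ('a \<Rightarrow> 'b) \<Rightarrow> 'b topology" where
  "quotient_topology T q = topology (\<lambda>U. U \<subseteq> q ` topspace T \<and> openin T {x \<in> topspace T. q x \<in> U})"

definition mm_scale :: "real \<Rightarrow> mm \<Rightarrow> mm" where
  "mm_scale t X = (mm_set X, (\<lambda>x y. t * mm_dist X x y), mm_meas X)"

definition scale_class :: "real \<Rightarrow> mm set \<Rightarrow> mm set" where
  "scale_class t A = {Y. mm_space Y \<and> (\<exists>X\<in>A. mm_iso (mm_scale t X) Y)}"

definition orbit :: "mm set \<Rightarrow> mm set set" where
  "orbit A = {scale_class t A | t. t > 0}"

definition Sigma_top :: "(mm \<Rightarrow> mm \<Rightarrow> real) \<Rightarrow> mm set set topology" where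
  "Sigma_top \<delta> = quotient_topology (subtopology (XX_top \<delta>) XX_star) orbit"

definition cone_map :: "'a set \<Rightarrow> 'a \<times> real \<Rightarrow> ('a \<times> real) set" where
  "cone_map S p = (if snd p = 0 then S \<times> {0} else {p})"

definition cone_top :: "'a topology \<Rightarrow> ('a \<times> real) set topology" where
  "cone_top T = quotient_topology (prod_topology T (subtopology euclideanreal {0..}))
                                  (cone_map (topspace T))"

end

theory Submission
  imports Defs
begin

text \<open>Regularity is the obstruction: \<open>XX\<close> and hence \<open>XX_star\<close> is pseudometrizable, so if it were a
  product with, or a cone over, \<open>\<Sigma>\<close>, then \<open>\<Sigma>\<close> would be regular. It is not. Let \<open>X\<close> be the space of two
  points at distance 1 with masses 1/2, let \<open>Y\<^sub>a\<close> be the one with masses \<open>1 - a\<close> and \<open>a\<close>, and let \<open>Z\<close> have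
  three points of masses 1/2, \<open>1/2 - a\<close>, \<open>a\<close>, the first two at distance 1 and the third at distance \<open>n\<close>
  from both. Then \<open>Z\<close> is \<open>a\<close>-close to \<open>X\<close>, whereas \<open>Z\<close> scaled by \<open>1/n\<close> is \<open>1/n\<close>-close to \<open>Y\<^sub>a\<close>. So the
  closure of any neighbourhood of the orbit of \<open>X\<close> contains the orbit of \<open>Y\<^sub>a\<close> for all small \<open>a\<close>. But positivity
  of the observable diameter with mass 1/4 discarded at either end is an open, scale-invariant property
  which holds for \<open>X\<close> and fails for \<open>Y\<^sub>a\<close> when \<open>a \<le> 1/4\<close>.

  For the triangle inequalities, two parameters of the same space are compared by cutting the space into
  countably many small pieces and rearranging the unit interval so that both parameters run through the
  pieces in the same order; this is done by quantile functions.\<close>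

section \<open>Measure-preserving maps of the unit interval\<close>

text \<open>One argument serves both topologies because each distance \<open>\<delta>\<close>
  satisfies \<open>conc \<le> \<delta> \<le> box_dist\<close>: closeness of the three-point spaces
  is shown for the box distance, the larger one, and openness of the invariant for the observable
  distance, the smaller one. Regularity needs only a pseudometric on representatives. What costs
  work is that both distances are infima over parameters. So every complete separable space must be
  shown to have a parameter, since otherwise the infimum runs over the empty set and its value means
  nothing; this comes from an explicit Borel code of the space in the real line with a Borel left
  inverse. And two parameters of the middle space in a triangle inequality need to be matched only
  up to an arbitrary \<open>\<eta> > 0\<close>, because an infimum tolerates any positive error. The
  level 1/4 is one choice among many: any number strictly between 0 and 1/2 tells the masses 1/2,
  1/2 from the masses \<open>1 - a\<close>, \<open>a\<close> with \<open>a\<close> small.\<close>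

lemma space_LI [simp]: "space LI = {0..<1}"
  by (simp add: LI_def space_restrict_space)

lemma sets_LI: "A \<in> sets LI \<longleftrightarrow> A \<subseteq> {0..<1} \<and> A \<in> sets borel"
  by (auto simp: LI_def sets_restrict_space_iff)

lemma prob_space_LI: "prob_space LI"
  by (rule prob_spaceI) (simp add: LI_def emeasure_restrict_space space_restrict_space)

interpretation LI: prob_space LI
  by (rule prob_space_LI)

lemma measurable_LI_ident: "(\<lambda>s. s) \<in> borel_measurable LI"
  by (simp add: LI_def measurable_restrict_space1)

lemma measurable_into_LI:
  assumes "f \<in> borel_measurable M" "\<And>x. x \<in> space M \<Longrightarrow> f x \<in> {0..<1}"
  shows "f \<in> measurable M LI"
  unfolding LI_def using assms by (intro measurable_restrict_space2) auto

lemma AE_LI_open_interval: "AE u in LI. u \<in> {0<..<1}"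
proof -
  have "AE u in lborel. u \<noteq> (0::real)" by (rule AE_lborel_singleton)
  then show ?thesis unfolding LI_def
    by (subst AE_restrict_space_iff) (auto elim!: eventually_mono)
qed

text \<open>\<open>I\<close> is the generalized inverse of the distribution function and lives on
  the open interval. \<open>Q\<close> extends it by 0 to the remaining point 0 of the unit interval,
  a null set; this arbitrary value is why monotonicity is asserted on \<open>{0<..<1}\<close>
  only.\<close>

lemma exists_quantile_function:
  fixes M :: "real measure"
  assumes "prob_space M" "sets M = sets borel"
  shows "\<exists>Q. Q \<in> borel_measurable LI \<and> distr LI borel Q = M \<and> mono_on {0<..<1} Q"
proof -
  interpret prob_space M by fact
  interpret cdf_distribution M
    using assms sets_eq_imp_space_eq[OF assms(2)]
    by (simp add: cdf_distribution_def real_distribution_def real_distribution_axioms_def)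
  define Q where "Q u = (if u \<in> {0<..<1} then I u else 0)" for u
  have Q: "Q \<in> borel_measurable borel"
    unfolding Q_def using measurable_CI
    by (subst measurable_If_restrict_space_iff) (auto simp: greaterThanLessThan_def Int_def greaterThan_def lessThan_def)
  then have QL: "Q \<in> borel_measurable LI"
    by (simp add: LI_def measurable_restrict_space1)
  have "distr LI borel Q = distr (restrict_space lborel {0<..<1}) borel I"
  proof (rule measure_eqI)
    fix A assume "A \<in> sets (distr LI borel Q)"
    then have A: "A \<in> sets borel" by simp
    have m: "Q -` A \<inter> {0..<1} \<in> sets lborel" "I -` A \<inter> {0<..<1} \<in> sets lborel"
      using measurable_sets[OF QL A] measurable_sets[OF measurable_CI A]
      by (auto simp: sets_LI sets_restrict_space_iff space_restrict_space)
    have "emeasure (distr LI borel Q) A = emeasure LI (Q -` A \<inter> {0..<1})"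
      using A by (simp add: emeasure_distr QL)
    also have "\<dots> = emeasure lborel (Q -` A \<inter> {0..<1})"
      by (simp add: LI_def emeasure_restrict_space)
    also have "\<dots> = emeasure lborel (I -` A \<inter> {0<..<1})"
      using AE_lborel_singleton[of "0::real"]
      by (intro emeasure_eq_AE m) (auto simp: Q_def)
    also have "\<dots> = emeasure (restrict_space lborel {0<..<1}) (I -` A \<inter> {0<..<1})"
      by (simp add: emeasure_restrict_space)
    also have "\<dots> = emeasure (distr (restrict_space lborel {0<..<1}) borel I) A"
      using A by (simp add: emeasure_distr space_restrict_space)
    finally show "emeasure (distr LI borel Q) A = \<dots>" .
  qed simp
  then have "distr LI borel Q = M" using distr_I_eq_M by simp
  moreover have "mono_on {0<..<1} Q"
    using mono_I unfolding mono_on_def Q_def by auto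
  ultimately show ?thesis using QL by blast
qed

text \<open>On the open interval the sublevel sets \<open>m \<le> k\<close> of a monotone function
  are initial segments, so those of \<open>m1\<close> and \<open>m2\<close> are nested. The common
  law gives them equal measure, hence they differ by a null set, and there are only countably many
  \<open>k\<close>.\<close>

lemma mono_nat_functions_eq_AE:
  fixes m1 m2 :: "real \<Rightarrow> nat"
  assumes [measurable]: "m1 \<in> measurable LI (count_space UNIV)" "m2 \<in> measurable LI (count_space UNIV)"
    and mono: "mono_on {0<..<1} m1" "mono_on {0<..<1} m2"
    and law: "distr LI (count_space UNIV) m1 = distr LI (count_space UNIV) m2"
  shows "AE u in LI. m1 u = m2 u"
proof -
  have "AE u in LI. m1 u \<le> k \<longleftrightarrow> m2 u \<le> k" for k
  proof -
    define A where "A m = {u \<in> space LI. m u \<le> k}" for m :: "real \<Rightarrow> nat"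
    have "A m = m -` {..k} \<inter> space LI" for m :: "real \<Rightarrow> nat" by (auto simp: A_def)
    then have [measurable]: "A m1 \<in> sets LI" "A m2 \<in> sets LI"
      using measurable_sets[OF assms(1), of "{..k}"] measurable_sets[OF assms(2), of "{..k}"] by auto
    have "measure (distr LI (count_space UNIV) m) {..k} = measure LI (A m)"
      if "m \<in> measurable LI (count_space UNIV)" for m
      using that by (subst measure_distr) (auto simp: A_def intro!: arg_cong[where f="measure LI"])
    then have eq: "measure LI (A m1) = measure LI (A m2)"
      using law assms(1,2) by metis
    have nested: "A m \<inter> {0<..<1} \<subseteq> A m' \<or> A m' \<inter> {0<..<1} \<subseteq> A m"
      if "mono_on {0<..<1} m" "mono_on {0<..<1} m'" for m m'
    proof (rule ccontr)
      assume "\<not> ?thesis"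
      then obtain u v where "u \<in> A m \<inter> {0<..<1}" "u \<notin> A m'" "v \<in> A m' \<inter> {0<..<1}" "v \<notin> A m"
        by blast
      then have uv: "u \<in> {0<..<1}" "v \<in> {0<..<1}" "m u \<le> k" "\<not> m' u \<le> k"
        "m' v \<le> k" "\<not> m v \<le> k" unfolding A_def by auto
      show False
      proof (cases "u \<le> v")
        case True with that(2) uv have "m' u \<le> m' v" by (auto simp: mono_on_def)
        with uv show False by simp
      next
        case False with that(1) uv have "m v \<le> m u" by (auto simp: mono_on_def)
        with uv show False by simp
      qed
    qed
    have key: "AE u in LI. u \<in> A m \<longrightarrow> u \<in> A m'" "AE u in LI. u \<in> A m' \<longrightarrow> u \<in> A m"
      if s: "A m \<inter> {0<..<1} \<subseteq> A m'" and [measurable]: "A m \<in> sets LI" "A m' \<in> sets LI"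
        and e: "measure LI (A m) = measure LI (A m')" for m m'
    proof -
      show 1: "AE u in LI. u \<in> A m \<longrightarrow> u \<in> A m'"
        using AE_LI_open_interval by eventually_elim (use s in auto)
      have "measure LI (A m' - A m) = measure LI (A m') - measure LI (A m' \<inter> A m)"
        by (simp add: LI.finite_measure_Diff')
      also have "measure LI (A m' \<inter> A m) = measure LI (A m)"
        using 1 by (intro measure_eq_AE) auto
      finally have "measure LI (A m' - A m) = 0" using e by simp
      then have "AE u in LI. u \<notin> A m' - A m"
        using LI.prob_eq_0 by auto
      then show "AE u in LI. u \<in> A m' \<longrightarrow> u \<in> A m" by eventually_elim auto
    qed
    have "(AE u in LI. u \<in> A m1 \<longrightarrow> u \<in> A m2) \<and> (AE u in LI. u \<in> A m2 \<longrightarrow> u \<in> A m1)"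
      using nested[OF mono] key[of m1 m2] key[of m2 m1] eq by auto
    then have a: "AE u in LI. u \<in> A m1 \<longrightarrow> u \<in> A m2" and b: "AE u in LI. u \<in> A m2 \<longrightarrow> u \<in> A m1"
      by auto
    show ?thesis
      using a b AE_space by eventually_elim (auto simp: A_def)
  qed
  then have "AE u in LI. \<forall>k. m1 u \<le> k \<longleftrightarrow> m2 u \<le> k" by (simp add: AE_all_countable)
  then show ?thesis by eventually_elim (metis order.refl order.antisym)
qed

text \<open>The quantile function of \<open>l s + s\<close> carries the label in its integer part and a
  measure-preserving map in its fractional part.\<close>
lemma exists_monotone_rearrangement_of_label:
  fixes l :: "real \<Rightarrow> nat"
  assumes [measurable]: "l \<in> measurable LI (count_space UNIV)"
  shows "\<exists>\<alpha> m. \<alpha> \<in> measurable LI LI \<and> distr LI LI \<alpha> = LI \<and> m \<in> measurable LI (count_space UNIV)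
    \<and> mono_on {0<..<1} m \<and> (AE u in LI. l (\<alpha> u) = m u)"
proof -
  define r where "r s = real (l s) + s" for s
  have "(\<lambda>s. real (l s)) \<in> borel_measurable LI" by (rule measurable_compose[OF assms]) simp
  then have r[measurable]: "r \<in> borel_measurable LI"
    unfolding r_def by (intro borel_measurable_add measurable_LI_ident)
  have "prob_space (distr LI borel r)" by (rule LI.prob_space_distr) simp
  from exists_quantile_function[OF this] obtain Q where
    Q[measurable]: "Q \<in> borel_measurable LI" and dQ: "distr LI borel Q = distr LI borel r"
    and mQ: "mono_on {0<..<1} Q" by auto
  have fl: "frac \<in> measurable borel LI"
  proof (rule measurable_into_LI)
    show "(frac :: real \<Rightarrow> real) \<in> borel_measurable borel"
      unfolding frac_def[abs_def] by (intro borel_measurable_diff borel_measurable_real_floor) simp_all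
  qed (simp add: frac_lt_1)
  define \<alpha> where "\<alpha> u = frac (Q u)" for u
  define m where "m u = nat \<lfloor>Q u\<rfloor>" for u
  have am: "\<alpha> \<in> measurable LI LI"
    unfolding \<alpha>_def using measurable_compose[OF Q fl] by simp
  have rf: "frac (r s) = s" "nat \<lfloor>r s\<rfloor> = l s" if "s \<in> {0..<1}" for s
    using that floor_eq_iff[of s 0] by (auto simp: r_def frac_unique_iff)
  have "distr LI LI \<alpha> = distr (distr LI borel Q) LI frac"
    by (subst distr_distr[OF fl Q]) (simp add: \<alpha>_def[abs_def] o_def)
  also have "\<dots> = distr LI LI (\<lambda>s. frac (r s))"
    unfolding dQ by (subst distr_distr[OF fl r]) (simp add: o_def)
  also have "\<dots> = distr LI LI (\<lambda>s. s)"
    by (rule distr_cong) (auto simp: rf)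
  finally have 1: "distr LI LI \<alpha> = LI" by (simp add: distr_id2)
  have 2: "m \<in> measurable LI (count_space UNIV)" unfolding m_def by measurable
  have 3: "mono_on {0<..<1} m"
    using mQ unfolding mono_on_def m_def by (auto intro!: nat_mono floor_mono)
  have lf[measurable]: "(\<lambda>y. l (frac y)) \<in> measurable borel (count_space UNIV)"
    by (rule measurable_compose[OF fl]) measurable
  have "(\<lambda>y. real (l (frac y))) \<in> borel_measurable borel"
    by (rule measurable_compose[OF lf]) simp
  \<comment> \<open>\<open>nat\<close> sends negative integers to 0, so \<open>max 0\<close> is its
    real-valued form. Written this way, the set where label and integer part agree is an equality
    set of two Borel functions.\<close>
  moreover have "(\<lambda>y::real. max 0 (real_of_int \<lfloor>y\<rfloor>)) \<in> borel_measurable borel"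
    by (intro borel_measurable_max borel_measurable_real_floor) simp_all
  ultimately have "{y \<in> space borel. real (l (frac y)) = max 0 (real_of_int \<lfloor>y\<rfloor>)} \<in> sets borel"
    by (rule borel_measurable_eq)
  moreover have "real k = max 0 (real_of_int z) \<longleftrightarrow> k = nat z" for k z by linarith
  ultimately have meas: "{y \<in> space borel. l (frac y) = nat \<lfloor>y\<rfloor>} \<in> sets borel" by simp
  \<comment> \<open>The identity holds along \<open>r\<close> by construction, hence almost surely
    for the law of \<open>r\<close>. Since \<open>Q\<close> has the same law it inherits the
    identity, although \<open>Q\<close> and \<open>r\<close> may differ pointwise.\<close>
  have "AE s in LI. l (frac (r s)) = nat \<lfloor>r s\<rfloor>"
    using AE_space by eventually_elim (simp add: rf)
  then have "AE y in distr LI borel r. l (frac y) = nat \<lfloor>y\<rfloor>"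
    using meas by (subst AE_distr_iff) auto
  then have "AE y in distr LI borel Q. l (frac y) = nat \<lfloor>y\<rfloor>" unfolding dQ .
  then have "AE u in LI. l (frac (Q u)) = nat \<lfloor>Q u\<rfloor>"
    by (rule AE_distrD[OF Q])
  then have 4: "AE u in LI. l (\<alpha> u) = m u" unfolding \<alpha>_def m_def .
  show ?thesis using am 1 2 3 4 by blast
qed

text \<open>Each label is rearranged into a monotone function. Rearranging by a measure-preserving
  map keeps the law, so the two monotone functions have equal laws and therefore coincide almost
  everywhere.\<close>

lemma exists_coupling_of_labels:
  fixes l1 l2 :: "real \<Rightarrow> nat"
  assumes [measurable]: "l1 \<in> measurable LI (count_space UNIV)" "l2 \<in> measurable LI (count_space UNIV)"
    and law: "distr LI (count_space UNIV) l1 = distr LI (count_space UNIV) l2"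
  shows "\<exists>\<alpha> \<beta>. \<alpha> \<in> measurable LI LI \<and> distr LI LI \<alpha> = LI \<and> \<beta> \<in> measurable LI LI \<and> distr LI LI \<beta> = LI
    \<and> (AE u in LI. l1 (\<alpha> u) = l2 (\<beta> u))"
proof -
  obtain \<alpha> m1 where a: "\<alpha> \<in> measurable LI LI" "distr LI LI \<alpha> = LI" "m1 \<in> measurable LI (count_space UNIV)"
    "mono_on {0<..<1} m1" and am: "AE u in LI. l1 (\<alpha> u) = m1 u"
    using exists_monotone_rearrangement_of_label[OF assms(1)] by blast
  obtain \<beta> m2 where b: "\<beta> \<in> measurable LI LI" "distr LI LI \<beta> = LI" "m2 \<in> measurable LI (count_space UNIV)"
    "mono_on {0<..<1} m2" and bm: "AE u in LI. l2 (\<beta> u) = m2 u"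
    using exists_monotone_rearrangement_of_label[OF assms(2)] by blast
  have law': "distr LI (count_space UNIV) m = distr LI (count_space UNIV) l"
    if [measurable]: "\<alpha> \<in> measurable LI LI" "m \<in> measurable LI (count_space UNIV)" "l \<in> measurable LI (count_space UNIV)"
      and d: "distr LI LI \<alpha> = LI" and ae: "AE u in LI. l (\<alpha> u) = m u" for \<alpha> and m l :: "real \<Rightarrow> nat"
  proof -
    have "distr LI (count_space UNIV) m = distr LI (count_space UNIV) (\<lambda>u. l (\<alpha> u))"
      using ae by (intro distr_cong_AE) auto
    also have "\<dots> = distr (distr LI LI \<alpha>) (count_space UNIV) l"
      by (subst distr_distr) (auto simp: o_def)
    finally show ?thesis by (simp add: d)
  qed
  have "AE u in LI. m1 u = m2 u"
    using a b law law'[OF a(1,3) assms(1) a(2) am] law'[OF b(1,3) assms(2) b(2) bm]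
    by (intro mono_nat_functions_eq_AE) auto
  with am bm have "AE u in LI. l1 (\<alpha> u) = l2 (\<beta> u)" by eventually_elim simp
  then show ?thesis using a b by blast
qed

section \<open>Existence of parameters\<close>

text \<open>Base 3 with digits 0 and 1 only, a Cantor-type expansion: unlike binary expansions it is
  injective, and each digit can be recovered by comparison with a threshold, so decoding is
  Borel.\<close>

definition ternary_code :: "(nat \<Rightarrow> bool) \<Rightarrow> real" where
  "ternary_code b = (\<Sum>j. of_bool (b j) * (1 / 3) ^ Suc j)"

fun ternary_digit :: "nat \<Rightarrow> real \<Rightarrow> bool" where
  "ternary_digit 0 z \<longleftrightarrow> z \<ge> 1 / 3"
| "ternary_digit (Suc j) z \<longleftrightarrow> ternary_digit j (3 * z - (if z \<ge> 1 / 3 then 1 else 0))"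

lemma summable_ternary_code: "summable (\<lambda>j. of_bool (b j) * (1 / 3 :: real) ^ Suc j)"
proof (rule summable_comparison_test')
  show "summable (\<lambda>j. (1 / 3 :: real) ^ Suc j)" by (simp add: summable_mult)
qed auto

lemma ternary_code_bounds: "0 \<le> ternary_code b" "ternary_code b \<le> 1 / 2"
proof -
  show "0 \<le> ternary_code b"
    unfolding ternary_code_def by (intro suminf_nonneg summable_ternary_code) auto
  have "ternary_code b \<le> (\<Sum>j. (1 / 3 :: real) ^ Suc j)"
    unfolding ternary_code_def
    by (intro suminf_le summable_ternary_code) (auto simp: summable_mult)
  also have "\<dots> = 1 / 2"
    using sums_mult[OF geometric_sums[of "1 / 3 :: real"], of "1 / 3"] by (simp add: sums_iff)
  finally show "ternary_code b \<le> 1 / 2" .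
qed

lemma ternary_code_Suc: "3 * ternary_code b = of_bool (b 0) + ternary_code (\<lambda>j. b (Suc j))"
proof -
  have "ternary_code b = of_bool (b 0) / 3 + (\<Sum>j. of_bool (b (Suc j)) * (1 / 3) ^ Suc (Suc j))"
    unfolding ternary_code_def using suminf_split_head[OF summable_ternary_code[of b]] by simp
  also have "(\<Sum>j. of_bool (b (Suc j)) * (1 / 3 :: real) ^ Suc (Suc j))
      = (\<Sum>j. 1 / 3 * (of_bool (b (Suc j)) * (1 / 3) ^ Suc j))"
    by (simp add: mult.left_commute)
  also have "\<dots> = 1 / 3 * ternary_code (\<lambda>j. b (Suc j))"
    unfolding ternary_code_def by (rule suminf_mult[OF summable_ternary_code])
  finally show ?thesis by simp
qed

text \<open>Tripling a code gives its leading bit plus the code of the shifted sequence, and the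
  latter lies in \<open>[0, 1/2]\<close>. So the leading bit is 1 exactly when the code is at least
  \<open>1/3\<close>, and removing it leaves the shifted sequence for the induction.\<close>

lemma ternary_digit_code: "ternary_digit j (ternary_code b) \<longleftrightarrow> b j"
proof (induction j arbitrary: b)
  have *: "ternary_code b \<ge> 1 / 3 \<longleftrightarrow> b 0" for b :: "nat \<Rightarrow> bool"
  proof -
    have "3 * ternary_code b = (if b 0 then 1 else 0) + ternary_code (\<lambda>j. b (Suc j))"
      using ternary_code_Suc[of b] by simp
    then show ?thesis
      using ternary_code_bounds[of "\<lambda>j. b (Suc j)"] by (cases "b 0") auto
  qed
  {
    case 0
    show ?case unfolding ternary_digit.simps by (rule *)
  next
    case (Suc j)
    have "3 * ternary_code b - (if ternary_code b \<ge> 1 / 3 then 1 else 0) = ternary_code (\<lambda>j. b (Suc j))"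
      using ternary_code_Suc[of b] unfolding * by simp
    then show ?case using Suc[of "\<lambda>j. b (Suc j)"] unfolding ternary_digit.simps by simp
  }
qed

lemma measurable_ternary_digit: "Measurable.pred borel (ternary_digit j)"
proof (induction j)
  case 0
  show ?case by simp
next
  case (Suc j)
  have "(\<lambda>z::real. 3 * z - (if z \<ge> 1 / 3 then 1 else 0)) \<in> borel_measurable borel" by measurable
  from measurable_compose[OF this Suc] show ?case by simp
qed

section \<open>Borel structure and real codes of a single mm-space\<close>

locale mm =
  fixes X :: mm
  assumes mm: "mm_space X"
begin

abbreviation "S \<equiv> mm_set X"
abbreviation "d \<equiv> mm_dist X"
abbreviation "\<mu> \<equiv> mm_meas X"

sublocale Metric_space S d
  using mm by (simp add: mm_space_def)

sublocale P: prob_space \<mu>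
  using mm by (simp add: mm_space_def)

lemma space_meas [simp]: "space \<mu> = S"
  using mm by (simp add: mm_space_def)

lemma complete: mcomplete
  using mm by (simp add: mm_space_def)

lemma open_in_sets: "openin mtopology U \<Longrightarrow> U \<in> sets \<mu>"
  using mm by (auto simp: mm_space_def borel_sets_of_def mm_top_def)

lemma nonempty: "S \<noteq> {}"
  using P.not_empty by simp

lemma measurable_by_open:
  assumes "f \<in> space M \<rightarrow> S" "\<And>U. openin mtopology U \<Longrightarrow> f -` U \<inter> space M \<in> sets M"
  shows "f \<in> measurable M \<mu>"
proof (rule measurable_sigma_sets[of _ S "{U. openin mtopology U}"])
  show "sets \<mu> = sigma_sets S {U. openin mtopology U}"
    using mm by (simp add: mm_space_def borel_sets_of_def mm_top_def)
  show "{U. openin mtopology U} \<subseteq> Pow S" using openin_subset[of mtopology] by auto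
qed (use assms in auto)

lemma lip1_measurable:
  assumes "f \<in> lip1 X"
  shows "f \<in> borel_measurable \<mu>"
proof (rule borel_measurableI_less)
  fix a
  have "openin mtopology {x \<in> S. f x < a}"
    unfolding openin_mtopology
  proof (intro conjI allI impI)
    fix x assume x: "x \<in> {x \<in> S. f x < a}"
    then have "mball x (a - f x) \<subseteq> {x \<in> S. f x < a}"
      using assms by (force simp: lip1_def)
    then show "\<exists>r>0. mball x r \<subseteq> {x \<in> S. f x < a}"
      using x by (intro exI[of _ "a - f x"]) auto
  qed auto
  then show "{x \<in> space \<mu>. f x < a} \<in> sets \<mu>" using open_in_sets by simp
qed

lemma dist_lip1: "x \<in> S \<Longrightarrow> d x \<in> lip1 X"
  unfolding lip1_def
proof (intro CollectI ballI)
  fix y z assume "x \<in> S" "y \<in> S" "z \<in> S"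
  then show "\<bar>d x y - d x z\<bar> \<le> d y z"
    using triangle[of x y z] triangle[of x z y] commute[of z y] by linarith
qed

lemma exists_dense_sequence:
  "\<exists>x :: nat \<Rightarrow> real. range x \<subseteq> S \<and> (\<forall>y\<in>S. \<forall>e>0. \<exists>k. d (x k) y < e)"
proof -
  obtain C where C: "countable C" "C \<subseteq> S" "mtopology closure_of C = S"
    using mm by (auto simp: mm_space_def separable_space_def mm_top_def)
  then have "C \<noteq> {}" using nonempty by auto
  have "\<exists>k. d (from_nat_into C k) y < e" if y: "y \<in> S" and e: "e > 0" for y e
  proof -
    have "y \<in> {x \<in> S. \<forall>r>0. \<exists>c\<in>C. c \<in> mball x r}"
      using y C(3) metric_closure_of[of C] by simp
    then obtain c where "c \<in> C" "c \<in> mball y e" using e by blast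
    then show ?thesis
      using from_nat_into_surj[OF C(1)] by (metis commute in_mball)
  qed
  then show ?thesis
    using range_from_nat_into_subset[OF \<open>C \<noteq> {}\<close>] C(2) by (intro exI[of _ "from_nat_into C"]) auto
qed

definition dense_seq :: "nat \<Rightarrow> real" where
  "dense_seq = (SOME x. range x \<subseteq> S \<and> (\<forall>y\<in>S. \<forall>e>0. \<exists>k. d (x k) y < e))"

lemma dense_seq_in [simp]: "dense_seq k \<in> S"
  and dense_seq_near: "y \<in> S \<Longrightarrow> e > 0 \<Longrightarrow> \<exists>k. d (dense_seq k) y < e"
  using someI_ex[OF exists_dense_sequence] unfolding dense_seq_def[symmetric] by auto

text \<open>By separability every open set is a countable union of balls of radius
  \<open>1 / Suc n\<close> about points of the dense sequence. Measurability of a map into the space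
  thus reduces to that of countably many real functions.\<close>

lemma measurable_by_dist:
  assumes f: "f \<in> space M \<rightarrow> S" and "\<And>k. (\<lambda>z. d (dense_seq k) (f z)) \<in> borel_measurable M"
  shows "f \<in> measurable M \<mu>"
proof (rule measurable_by_open[OF f])
  fix U assume U: "openin mtopology U"
  define R where "R = {p. mball (dense_seq (fst p)) (1 / Suc (snd p)) \<subseteq> U}"
  have near: "\<exists>p\<in>R. d (dense_seq (fst p)) y < 1 / Suc (snd p)" if "y \<in> U" for y
  proof -
    obtain r where r: "r > 0" "mball y r \<subseteq> U" and y: "y \<in> S"
      using U \<open>y \<in> U\<close> unfolding openin_mtopology by blast
    obtain n where n: "1 / Suc n < r / 2"
      using reals_Archimedean[of "r / 2"] r by (auto simp: inverse_eq_divide)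
    obtain k where k: "d (dense_seq k) y < 1 / Suc n" using dense_seq_near[OF y, of "1 / Suc n"] by auto
    have "mball (dense_seq k) (1 / Suc n) \<subseteq> mball y r"
    proof
      fix w assume "w \<in> mball (dense_seq k) (1 / Suc n)"
      then have "w \<in> S" "d (dense_seq k) w < 1 / Suc n" by auto
      moreover have "d y w \<le> d y (dense_seq k) + d (dense_seq k) w"
        using triangle y \<open>w \<in> S\<close> by simp
      ultimately show "w \<in> mball y r" using n k y by (simp add: commute)
    qed
    with r k show ?thesis by (auto simp: R_def intro!: bexI[of _ "(k, n)"])
  qed

  have "f -` U \<inter> space M = (\<Union>p\<in>R. {z \<in> space M. d (dense_seq (fst p)) (f z) < 1 / Suc (snd p)})"
  proof (intro equalityI subsetI)
    fix z assume "z \<in> f -` U \<inter> space M"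
    then show "z \<in> (\<Union>p\<in>R. {z \<in> space M. d (dense_seq (fst p)) (f z) < 1 / Suc (snd p)})"
      using near[of "f z"] by blast
  next
    fix z assume "z \<in> (\<Union>p\<in>R. {z \<in> space M. d (dense_seq (fst p)) (f z) < 1 / Suc (snd p)})"
    then obtain p where p: "p \<in> R" "z \<in> space M" "d (dense_seq (fst p)) (f z) < 1 / Suc (snd p)" by blast
    then have "f z \<in> mball (dense_seq (fst p)) (1 / Suc (snd p))" using f by auto
    then show "z \<in> f -` U \<inter> space M" using p by (auto simp: R_def case_prod_beta)
  qed
  also have "\<dots> \<in> sets M"
  proof (rule sets.countable_UN'')
    fix p assume "p \<in> R"
    show "{z \<in> space M. d (dense_seq (fst p)) (f z) < 1 / Suc (snd p)} \<in> sets M"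
      using assms(2) by (intro borel_measurable_less) simp_all
  qed auto
  finally show "f -` U \<inter> space M \<in> sets M" .
qed

text \<open>A point \<open>y\<close> is coded by the answers to all questions whether
  \<open>dense_seq k\<close> is within \<open>(1 / 2) ^ n\<close> of \<open>y\<close>. Decoding
  takes, for each \<open>n\<close>, the first \<open>k\<close> answered positively, and passes to
  the limit of these dense points, which exists by completeness.\<close>

lemma exists_real_code:
  "\<exists>(e :: real \<Rightarrow> real) \<phi>. e \<in> borel_measurable \<mu> \<and> \<phi> \<in> measurable borel \<mu> \<and> (\<forall>y\<in>S. \<phi> (e y) = y)"
proof -
  define e where "e y = ternary_code (\<lambda>j. case prod_decode j of (n, k) \<Rightarrow> d (dense_seq k) y < (1 / 2) ^ n)" for y
  define bit where "bit n k = ternary_digit (prod_encode (n, k))" for n k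
  define lab where "lab n z = (LEAST k. bit n k z)" for n z
  define x where "x n z = dense_seq (lab n z)" for n z
  \<comment> \<open>For the code of an actual point this is the triangle inequality. Conversely it
    makes the decoded sequence Cauchy, so \<open>G\<close> is a Borel set on which the limit exists;
    off \<open>G\<close> the decoder takes a constant value.\<close>
  define G where "G = {z. \<forall>n m. d (x n z) (x m z) < (1 / 2) ^ n + (1 / 2) ^ m}"
  have bit_e: "bit n k (e y) \<longleftrightarrow> d (dense_seq k) y < (1 / 2) ^ n" for n k y
    unfolding bit_def e_def by (simp add: ternary_digit_code)
  have x_e: "d (x n (e y)) y < (1 / 2) ^ n" if "y \<in> S" for n y
    unfolding x_def lab_def bit_e using dense_seq_near[OF that, of "(1 / 2) ^ n"]
    by (auto intro: LeastI_ex)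
  have e_G: "e y \<in> G" if y: "y \<in> S" for y
  proof -
    have "d (x n (e y)) (x m (e y)) < (1 / 2) ^ n + (1 / 2) ^ m" for n m
      using x_e[OF y, of n] x_e[OF y, of m] triangle[of "x n (e y)" y "x m (e y)"] y
        commute[of y "x m (e y)"] unfolding x_def by auto
    then show ?thesis by (auto simp: G_def)
  qed
  have "\<exists>l. z \<in> G \<longrightarrow> limitin mtopology (\<lambda>n. x n z) l sequentially" for z
  proof (cases "z \<in> G")
    case True
    have "MCauchy (\<lambda>n. x n z)"
      unfolding MCauchy_def
    proof (intro conjI allI impI)
      show "range (\<lambda>n. x n z) \<subseteq> S" by (auto simp: x_def)
      fix \<epsilon> :: real assume "\<epsilon> > 0"
      then obtain N where N: "(1 / 2 :: real) ^ N < \<epsilon> / 2"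
        using real_arch_pow_inv[of "\<epsilon> / 2" "1 / 2"] by auto
      have "d (x n z) (x m z) < \<epsilon>" if "N \<le> n" "N \<le> m" for n m
      proof -
        have "(1 / 2 :: real) ^ n \<le> (1 / 2) ^ N" "(1 / 2 :: real) ^ m \<le> (1 / 2) ^ N"
          using that by (auto intro!: power_decreasing)
        moreover have "d (x n z) (x m z) < (1 / 2) ^ n + (1 / 2) ^ m" using True by (auto simp: G_def)
        ultimately show ?thesis using N by linarith
      qed
      then show "\<exists>N. \<forall>n n'. N \<le> n \<longrightarrow> N \<le> n' \<longrightarrow> d (x n z) (x n' z) < \<epsilon>" by blast
    qed
    then show ?thesis using complete by (auto simp: mcomplete_def)
  qed simp
  then obtain l where l: "\<And>z. z \<in> G \<Longrightarrow> limitin mtopology (\<lambda>n. x n z) (l z) sequentially"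
    by metis
  then have lS: "l z \<in> S" if "z \<in> G" for z
    using that limitin_mspace by blast
  define \<phi> where "\<phi> z = (if z \<in> G then l z else dense_seq 0)" for z
  have lab[measurable]: "lab n \<in> measurable borel (count_space UNIV)" for n
    unfolding lab_def[abs_def] bit_def by (rule measurable_Least) (rule measurable_ternary_digit)
  have dx: "(\<lambda>z. d (dense_seq k) (x n z)) \<in> borel_measurable borel" for k n
    unfolding x_def by (rule measurable_compose[OF lab]) simp
  have dxx: "(\<lambda>z. d (x m z) (x n z)) \<in> borel_measurable borel" for m n
    unfolding x_def
    by (rule measurable_compose_countable[OF _ lab[of m], where f = "\<lambda>i z. d (dense_seq i) (dense_seq (lab n z))"])
       (rule measurable_compose[OF lab], simp)
  have "G = (\<Inter>n m. {z \<in> space borel. d (x n z) (x m z) < (1 / 2) ^ n + (1 / 2) ^ m})"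
    by (auto simp: G_def)
  also have "\<dots> \<in> sets borel"
    using dxx by (intro sets.countable_INT'' borel_measurable_less) auto
  finally have G[measurable]: "G \<in> sets borel" .
  \<comment> \<open>On \<open>G\<close> the distance to the decoded point is the pointwise limit of
    the distances to the approximants \<open>x n z\<close>, which are Borel because the label takes
    countably many values.\<close>
  have dl: "(\<lambda>z. d (dense_seq k) (\<phi> z)) \<in> borel_measurable borel" for k
  proof (rule borel_measurable_LIMSEQ_real[where
        u = "\<lambda>n z. if z \<in> G then d (dense_seq k) (x n z) else d (dense_seq k) (dense_seq 0)"])
    fix z
    show "(\<lambda>n. if z \<in> G then d (dense_seq k) (x n z) else d (dense_seq k) (dense_seq 0))
        \<longlonglongrightarrow> d (dense_seq k) (\<phi> z)"
    proof (cases "z \<in> G")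
      case True
      have lim: "(\<lambda>n. d (x n z) (l z)) \<longlonglongrightarrow> 0"
        using l[OF True] unfolding limitin_metric_dist_null by blast
      have le: "\<bar>d (dense_seq k) (x n z) - d (dense_seq k) (l z)\<bar> \<le> d (x n z) (l z)" for n
        using dist_lip1[of "dense_seq k"] lS[OF True] unfolding lip1_def x_def by simp
      have "(\<lambda>n. d (dense_seq k) (x n z) - d (dense_seq k) (l z)) \<longlonglongrightarrow> 0"
        by (rule tendsto_0_le[OF lim always_eventually, of _ 1]) (simp add: le)
      then show ?thesis using True by (simp add: \<phi>_def LIM_zero_iff)
    qed (simp add: \<phi>_def)
  next
    fix n
    show "(\<lambda>z. if z \<in> G then d (dense_seq k) (x n z) else d (dense_seq k) (dense_seq 0)) \<in> borel_measurable borel"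
      using G by (intro measurable_If dx borel_measurable_const) simp_all
  qed
  have "\<phi> z \<in> S" for z
    by (cases "z \<in> G") (simp_all add: \<phi>_def lS)
  then have "\<phi> \<in> measurable borel \<mu>"
    by (intro measurable_by_dist[OF _ dl]) simp
  moreover have "e \<in> borel_measurable \<mu>"
    unfolding e_def ternary_code_def
  proof (intro borel_measurable_suminf borel_measurable_times borel_measurable_const)
    fix j
    obtain n k where nk: "prod_decode j = (n, k)" by fastforce
    have [measurable]: "d (dense_seq k) \<in> borel_measurable \<mu>" by (intro lip1_measurable dist_lip1) simp
    show "(\<lambda>y. of_bool (case prod_decode j of (n, k) \<Rightarrow> d (dense_seq k) y < (1 / 2) ^ n) :: real) \<in> borel_measurable \<mu>"
      unfolding nk by simp
  qed
  moreover have "\<phi> (e y) = y" if y: "y \<in> S" for y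
  proof -
    have "(\<lambda>n. d (x n (e y)) y) \<longlonglongrightarrow> 0"
    proof (rule tendsto_0_le[of "\<lambda>n. (1 / 2) ^ n" _ _ 1, OF _ always_eventually])
      show "(\<lambda>n. (1 / 2 :: real) ^ n) \<longlonglongrightarrow> 0" by (rule LIMSEQ_realpow_zero) simp_all
    qed (use x_e[OF y] in \<open>simp add: less_imp_le\<close>)
    then have "limitin mtopology (\<lambda>n. x n (e y)) y sequentially"
      using y by (simp add: limitin_metric_dist_null x_def)
    then show ?thesis
      using limitin_metric_unique[OF l[OF e_G[OF y]]] e_G[OF y] by (simp add: \<phi>_def)
  qed
  ultimately show ?thesis by blast
qed

text \<open>The measure is pushed to the line by the code \<open>e\<close>, realized there by a
  quantile function, and pulled back by the decoder; the decoder undoes \<open>e\<close>, so the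
  original measure returns.\<close>

lemma exists_parameter: "\<exists>\<phi>. parameter X \<phi>"
proof -
  obtain e :: "real \<Rightarrow> real" and \<phi> where e[measurable]: "e \<in> borel_measurable \<mu>" and \<phi>[measurable]: "\<phi> \<in> measurable borel \<mu>"
    and \<phi>e: "\<forall>y\<in>S. \<phi> (e y) = y"
    using exists_real_code by blast
  have "prob_space (distr \<mu> borel e)" by (rule P.prob_space_distr) simp
  from exists_quantile_function[OF this] obtain Q where
    Q: "Q \<in> borel_measurable LI" and dQ: "distr LI borel Q = distr \<mu> borel e" by auto
  have "distr LI \<mu> (\<phi> \<circ> Q) = distr (distr LI borel Q) \<mu> \<phi>"
    by (rule distr_distr[symmetric, OF \<phi> Q])
  also have "\<dots> = distr \<mu> \<mu> (\<phi> \<circ> e)"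
    unfolding dQ by (rule distr_distr[OF \<phi> e])
  also have "\<dots> = distr \<mu> \<mu> (\<lambda>y. y)"
    using \<phi>e by (intro distr_cong) auto
  finally have "distr LI \<mu> (\<phi> \<circ> Q) = \<mu>" by (simp add: distr_id2)
  then show ?thesis
    using measurable_comp[OF Q \<phi>] by (auto simp: parameter_def)
qed

end

section \<open>The box distance\<close>

definition measure_preserving_LI :: "(real \<Rightarrow> real) \<Rightarrow> bool" where
  "measure_preserving_LI \<alpha> \<longleftrightarrow> \<alpha> \<in> measurable LI LI \<and> distr LI LI \<alpha> = LI"

lemma measure_preserving_vimage:
  assumes "measure_preserving_LI \<alpha>" "A \<in> sets LI"
  shows "\<alpha> -` A \<inter> {0..<1} \<in> sets LI" "measure LI (\<alpha> -` A \<inter> {0..<1}) = measure LI A"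
proof -
  have \<alpha>: "\<alpha> \<in> measurable LI LI" "distr LI LI \<alpha> = LI"
    using assms(1) by (simp_all add: measure_preserving_LI_def)
  show "\<alpha> -` A \<inter> {0..<1} \<in> sets LI" using measurable_sets[OF \<alpha>(1) assms(2)] by simp
  show "measure LI (\<alpha> -` A \<inter> {0..<1}) = measure LI A"
    using measure_distr[OF \<alpha>(1) assms(2)] unfolding \<alpha>(2) space_LI by (rule sym)
qed

lemma parameter_comp:
  assumes "parameter X \<phi>" "measure_preserving_LI \<alpha>"
  shows "parameter X (\<phi> \<circ> \<alpha>)"
  using assms measurable_comp[of \<alpha> LI LI \<phi> "mm_meas X"] distr_distr[of \<phi> LI "mm_meas X" \<alpha> LI]
  by (simp add: parameter_def measure_preserving_LI_def)

lemma parameter_in: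
  assumes "mm_space X" "parameter X \<phi>" "s \<in> {0..<1}"
  shows "\<phi> s \<in> mm_set X"
  using assms measurable_space[of \<phi> LI "mm_meas X" s] by (simp add: parameter_def mm_space_def)

context mm
begin

text \<open>Label a point by the first dense point within \<open>\<eta> / 2\<close>. The labels seen
  through \<open>\<phi>\<close> and through \<open>\<psi>\<close> both have the law of
  \<open>lab\<close> under the measure of the space, so they can be made equal almost everywhere,
  and two points with the same label are within \<open>\<eta>\<close>.\<close>

lemma exists_approximate_coupling:
  assumes \<phi>: "parameter X \<phi>" and \<psi>: "parameter X \<psi>" and "\<eta> > 0"
  shows "\<exists>\<alpha> \<beta>. measure_preserving_LI \<alpha> \<and> measure_preserving_LI \<beta> \<and> (AE u in LI. d (\<phi> (\<alpha> u)) (\<psi> (\<beta> u)) \<le> \<eta>)"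
proof -
  define lab where "lab y = (LEAST k. d (dense_seq k) y < \<eta> / 2)" for y
  have lab_near: "d (dense_seq (lab y)) y < \<eta> / 2" if "y \<in> S" for y
    unfolding lab_def by (rule LeastI_ex, rule dense_seq_near[OF that]) (use \<open>\<eta> > 0\<close> in simp)
  have lab: "lab \<in> measurable \<mu> (count_space UNIV)"
    unfolding lab_def[abs_def]
  proof (rule measurable_Least)
    fix k
    have [measurable]: "d (dense_seq k) \<in> borel_measurable \<mu>" by (intro lip1_measurable dist_lip1) simp
    show "Measurable.pred \<mu> (\<lambda>y. d (dense_seq k) y < \<eta> / 2)" by simp
  qed
  have p: "\<phi> \<in> measurable LI \<mu>" "distr LI \<mu> \<phi> = \<mu>" "\<psi> \<in> measurable LI \<mu>" "distr LI \<mu> \<psi> = \<mu>"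
    using \<phi> \<psi> unfolding parameter_def by blast+
  have "distr LI (count_space UNIV) (lab \<circ> \<phi>) = distr LI (count_space UNIV) (lab \<circ> \<psi>)"
    using distr_distr[OF lab p(1)] distr_distr[OF lab p(3)] unfolding p(2,4) by (rule trans[OF sym])
  from exists_coupling_of_labels[OF measurable_comp[OF p(1) lab] measurable_comp[OF p(3) lab] this]
  obtain \<alpha> \<beta> where ab: "measure_preserving_LI \<alpha>" "measure_preserving_LI \<beta>"
    and eq: "AE u in LI. lab (\<phi> (\<alpha> u)) = lab (\<psi> (\<beta> u))"
    unfolding measure_preserving_LI_def o_def by blast
  have "AE u in LI. d (\<phi> (\<alpha> u)) (\<psi> (\<beta> u)) \<le> \<eta>"
    using eq AE_space
  proof eventually_elim
    case (elim u)
    let ?x = "\<phi> (\<alpha> u)" and ?y = "\<psi> (\<beta> u)"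
    have x: "?x \<in> S" and y: "?y \<in> S"
      using parameter_in[OF mm parameter_comp[OF \<phi> ab(1)], of u]
        parameter_in[OF mm parameter_comp[OF \<psi> ab(2)], of u] elim by simp_all
    have "d ?x ?y \<le> d (dense_seq (lab ?x)) ?x + d (dense_seq (lab ?y)) ?y"
      using triangle[OF x dense_seq_in y, of "lab ?x"] commute[of "?x" "dense_seq (lab ?x)"]
      unfolding elim(1) by linarith
    then show ?case using lab_near[OF x] lab_near[OF y] by linarith
  qed
  with ab show ?thesis by blast
qed

end

definition box_witness :: "mm \<Rightarrow> mm \<Rightarrow> real \<Rightarrow> (real \<Rightarrow> real) \<Rightarrow> (real \<Rightarrow> real) \<Rightarrow> real set \<Rightarrow> bool" where
  "box_witness X Y \<epsilon> \<phi> \<psi> I0 \<longleftrightarrow> 0 \<le> \<epsilon> \<and> parameter X \<phi> \<and> parameter Y \<psi> \<and> I0 \<in> sets LI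
      \<and> measure LI I0 \<ge> 1 - \<epsilon>
      \<and> (\<forall>s\<in>I0. \<forall>t\<in>I0. \<bar>mm_dist X (\<phi> s) (\<phi> t) - mm_dist Y (\<psi> s) (\<psi> t)\<bar> \<le> \<epsilon>)"

lemma box_dist_eq: "box_dist X Y = Inf {\<epsilon>. \<exists>\<phi> \<psi> I0. box_witness X Y \<epsilon> \<phi> \<psi> I0}"
  unfolding box_dist_def box_witness_def by (rule arg_cong[where f = Inf]) auto

lemma box_dist_le:
  assumes "box_witness X Y \<epsilon> \<phi> \<psi> I0"
  shows "box_dist X Y \<le> \<epsilon>"
  unfolding box_dist_eq
proof (rule cInf_lower)
  show "bdd_below {\<epsilon>. \<exists>\<phi> \<psi> I0. box_witness X Y \<epsilon> \<phi> \<psi> I0}"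
    by (rule bdd_belowI[of _ 0]) (auto simp: box_witness_def)
qed (use assms in auto)

lemma trivial_box_witness:
  assumes "parameter X \<phi>" "parameter Y \<psi>"
  shows "box_witness X Y 1 \<phi> \<psi> {}"
  using assms by (simp add: box_witness_def)

text \<open>The set of admissible \<open>\<epsilon>\<close> is nonempty: parameters exist, and with
  them \<open>\<epsilon> = 1\<close> and the empty \<open>I0\<close> always qualify. Only then does
  the infimum yield a witness.\<close>

lemma box_dist_less:
  assumes "mm_space X" "mm_space Y" "box_dist X Y < e"
  obtains \<epsilon> \<phi> \<psi> I0 where "\<epsilon> < e" "box_witness X Y \<epsilon> \<phi> \<psi> I0"
proof -
  obtain \<phi> \<psi> where "parameter X \<phi>" "parameter Y \<psi>"
    using mm.exists_parameter[OF mm.intro] assms(1,2) by blast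
  then have "{\<epsilon>. \<exists>\<phi> \<psi> I0. box_witness X Y \<epsilon> \<phi> \<psi> I0} \<noteq> {}"
    using trivial_box_witness by blast
  from cInf_lessD[OF this assms(3)[unfolded box_dist_eq]] show ?thesis using that by blast
qed

lemma box_dist_commute: "box_dist X Y = box_dist Y X"
proof -
  have "box_witness X Y \<epsilon> \<phi> \<psi> I0 \<longleftrightarrow> box_witness Y X \<epsilon> \<psi> \<phi> I0" for \<epsilon> \<phi> \<psi> I0
    unfolding box_witness_def by (simp add: abs_minus_commute) blast
  then have "{\<epsilon>. \<exists>\<phi> \<psi> I0. box_witness X Y \<epsilon> \<phi> \<psi> I0} = {\<epsilon>. \<exists>\<phi> \<psi> I0. box_witness Y X \<epsilon> \<phi> \<psi> I0}"
    by blast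
  then show ?thesis by (simp add: box_dist_eq)
qed

lemma prob_Int_ge:
  assumes "A \<in> sets LI" "B \<in> sets LI"
  shows "measure LI (A \<inter> B) \<ge> measure LI A + measure LI B - 1"
proof -
  have "measure LI (A \<union> B) = measure LI A + measure LI (B - A)"
    using assms by (rule LI.finite_measure_Union')
  moreover have "measure LI (B - A) = measure LI B - measure LI (B \<inter> A)"
    using assms by (intro LI.finite_measure_Diff') auto
  moreover have "measure LI (A \<union> B) \<le> 1" by (rule LI.prob_le_1)
  ultimately show ?thesis by (simp add: Int_commute)
qed

text \<open>After rearrangement by \<open>\<alpha>\<close> and \<open>\<beta>\<close> the two
  parameters of \<open>Y\<close> are \<open>e / 4\<close>-close almost everywhere, so switching from
  one to the other changes distances in \<open>Y\<close> by at most \<open>e / 2\<close>. The other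
  half of \<open>e\<close> pays for the two nearly optimal witnesses.\<close>

lemma box_dist_triangle:
  assumes X: "mm_space X" and Y: "mm_space Y" and Z: "mm_space Z"
  shows "box_dist X Z \<le> box_dist X Y + box_dist Y Z"
proof (rule field_le_epsilon)
  fix e :: real assume "e > 0"
  interpret Y: mm Y using Y by (rule mm.intro)
  have less1: "box_dist X Y < box_dist X Y + e / 4" and less2: "box_dist Y Z < box_dist Y Z + e / 4"
    using \<open>e > 0\<close> by simp_all
  obtain \<epsilon>1 \<phi>1 \<psi>1 I1 where e1: "\<epsilon>1 < box_dist X Y + e / 4" and w1: "box_witness X Y \<epsilon>1 \<phi>1 \<psi>1 I1"
    using box_dist_less[OF X Y less1] by blast
  obtain \<epsilon>2 \<phi>2 \<psi>2 I2 where e2: "\<epsilon>2 < box_dist Y Z + e / 4" and w2: "box_witness Y Z \<epsilon>2 \<phi>2 \<psi>2 I2"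
    using box_dist_less[OF Y Z less2] by blast
  have "parameter Y \<psi>1" "parameter Y \<phi>2" "e / 4 > 0"
    using w1 w2 \<open>e > 0\<close> by (simp_all add: box_witness_def)
  from Y.exists_approximate_coupling[OF this] obtain \<alpha> \<beta>
    where \<alpha>: "measure_preserving_LI \<alpha>" and \<beta>: "measure_preserving_LI \<beta>"
      and ae: "AE u in LI. Y.d (\<psi>1 (\<alpha> u)) (\<phi>2 (\<beta> u)) \<le> e / 4" by blast
  obtain N where N: "{u \<in> space LI. \<not> Y.d (\<psi>1 (\<alpha> u)) (\<phi>2 (\<beta> u)) \<le> e / 4} \<subseteq> N"
      "emeasure LI N = 0" "N \<in> sets LI"
    by (rule AE_E[OF ae])
  define A where "A = \<alpha> -` I1 \<inter> {0..<1}"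
  define B where "B = \<beta> -` I2 \<inter> {0..<1}"
  have AB: "A \<in> sets LI" "B \<in> sets LI" "measure LI A \<ge> 1 - \<epsilon>1" "measure LI B \<ge> 1 - \<epsilon>2"
    using measure_preserving_vimage[OF \<alpha>, of I1] measure_preserving_vimage[OF \<beta>, of I2] w1 w2
    by (simp_all add: A_def B_def box_witness_def)
  have "measure LI (A \<inter> B - N) = measure LI (A \<inter> B)"
    using N(2,3) AB(1,2) by (intro measure_Diff_null_set sets.Int null_setsI) simp_all
  then have m: "measure LI (A \<inter> B - N) \<ge> 1 - (\<epsilon>1 + \<epsilon>2 + e / 2)"
    using prob_Int_ge[OF AB(1,2)] AB(3,4) \<open>e > 0\<close> by linarith
  have "\<bar>mm_dist X (\<phi>1 (\<alpha> s)) (\<phi>1 (\<alpha> t)) - mm_dist Z (\<psi>2 (\<beta> s)) (\<psi>2 (\<beta> t))\<bar> \<le> \<epsilon>1 + \<epsilon>2 + e / 2"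
    if s: "s \<in> A \<inter> B - N" and t: "t \<in> A \<inter> B - N" for s t
  proof -
    have S: "s \<in> {0..<1}" "t \<in> {0..<1}" using s t by (auto simp: A_def)
    have 1: "\<bar>mm_dist X (\<phi>1 (\<alpha> s)) (\<phi>1 (\<alpha> t)) - Y.d (\<psi>1 (\<alpha> s)) (\<psi>1 (\<alpha> t))\<bar> \<le> \<epsilon>1"
      using s t w1 by (simp add: A_def box_witness_def)
    have 2: "\<bar>Y.d (\<phi>2 (\<beta> s)) (\<phi>2 (\<beta> t)) - mm_dist Z (\<psi>2 (\<beta> s)) (\<psi>2 (\<beta> t))\<bar> \<le> \<epsilon>2"
      using s t w2 by (simp add: B_def box_witness_def)
    have 3: "Y.d (\<psi>1 (\<alpha> s)) (\<phi>2 (\<beta> s)) \<le> e / 4" "Y.d (\<psi>1 (\<alpha> t)) (\<phi>2 (\<beta> t)) \<le> e / 4"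
      using s t N(1) S by auto
    have in1: "\<psi>1 (\<alpha> u) \<in> Y.S" if "u \<in> {0..<1}" for u
      using parameter_in[OF Y parameter_comp[OF _ \<alpha>] that, of \<psi>1] w1 by (simp add: box_witness_def)
    have in2: "\<phi>2 (\<beta> u) \<in> Y.S" if "u \<in> {0..<1}" for u
      using parameter_in[OF Y parameter_comp[OF _ \<beta>] that, of \<phi>2] w2 by (simp add: box_witness_def)
    note I = in1[OF S(1)] in1[OF S(2)] in2[OF S(1)] in2[OF S(2)]
    have "\<bar>Y.d (\<psi>1 (\<alpha> s)) (\<psi>1 (\<alpha> t)) - Y.d (\<phi>2 (\<beta> s)) (\<phi>2 (\<beta> t))\<bar> \<le> e / 2"
      using Y.triangle[OF I(1,3,2)] Y.triangle[OF I(3,4,2)] Y.triangle[OF I(3,1,4)] Y.triangle[OF I(1,2,4)] 3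
        Y.commute[of "\<psi>1 (\<alpha> s)" "\<phi>2 (\<beta> s)"] Y.commute[of "\<psi>1 (\<alpha> t)" "\<phi>2 (\<beta> t)"]
      by linarith
    with 1 2 show ?thesis by linarith
  qed
  then have "box_witness X Z (\<epsilon>1 + \<epsilon>2 + e / 2) (\<phi>1 \<circ> \<alpha>) (\<psi>2 \<circ> \<beta>) (A \<inter> B - N)"
    using w1 w2 m AB(1,2) N(3) \<open>e > 0\<close> parameter_comp[OF _ \<alpha>, of X \<phi>1] parameter_comp[OF _ \<beta>, of Z \<psi>2]
    unfolding box_witness_def o_def by (intro conjI ballI) simp_all
  from box_dist_le[OF this] e1 e2 show "box_dist X Z \<le> box_dist X Y + box_dist Y Z + e" by linarith
qed

section \<open>The observable distance\<close>

lemma ky_fan_le: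
  assumes "0 \<le> \<epsilon>" "measure LI {s \<in> {0..<1}. \<bar>f s - g s\<bar> > \<epsilon>} \<le> \<epsilon>"
  shows "ky_fan f g \<le> \<epsilon>"
  unfolding ky_fan_def
proof (rule cInf_lower)
  show "bdd_below {\<epsilon>. 0 \<le> \<epsilon> \<and> measure LI {s \<in> {0..<1}. \<epsilon> < \<bar>f s - g s\<bar>} \<le> \<epsilon>}"
    by (rule bdd_belowI[of _ 0]) simp
qed (use assms in simp)

lemma ky_fan_less:
  assumes "ky_fan f g < e"
  obtains \<epsilon> where "0 \<le> \<epsilon>" "\<epsilon> < e" "measure LI {s \<in> {0..<1}. \<bar>f s - g s\<bar> > \<epsilon>} \<le> \<epsilon>"
proof -
  have "1 \<in> {\<epsilon>. 0 \<le> \<epsilon> \<and> measure LI {s \<in> {0..<1}. \<epsilon> < \<bar>f s - g s\<bar>} \<le> \<epsilon>}" by simp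
  then have "{\<epsilon>. 0 \<le> \<epsilon> \<and> measure LI {s \<in> {0..<1}. \<epsilon> < \<bar>f s - g s\<bar>} \<le> \<epsilon>} \<noteq> {}" by blast
  from cInf_lessD[OF this assms[unfolded ky_fan_def]] show ?thesis using that by blast
qed

lemma ky_fan_le_1: "ky_fan f g \<le> 1"
  by (rule ky_fan_le) simp_all

lemma ky_fan_nonneg: "0 \<le> ky_fan f g"
proof (rule ccontr)
  assume "\<not> ?thesis"
  then have "ky_fan f g < 0" by simp
  then show False by (rule ky_fan_less) simp
qed

lemma ky_fan_commute: "ky_fan f g = ky_fan g f"
  by (simp add: ky_fan_def abs_minus_commute)

lemma deviation_in_sets:
  assumes "f \<in> borel_measurable LI" "g \<in> borel_measurable LI"
  shows "{s \<in> {0..<1}. \<bar>f s - g s\<bar> > (\<epsilon> :: real)} \<in> sets LI"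
proof -
  have "{s \<in> space LI. \<epsilon> < \<bar>f s - g s\<bar>} \<in> sets LI"
    using assms by (intro borel_measurable_less borel_measurable_abs borel_measurable_diff borel_measurable_const)
  then show ?thesis by simp
qed

lemma ky_fan_triangle:
  assumes f: "f \<in> borel_measurable LI" and g: "g \<in> borel_measurable LI" and h: "h \<in> borel_measurable LI"
  shows "ky_fan f h \<le> ky_fan f g + ky_fan g h"
proof (rule field_le_epsilon)
  fix e :: real assume "e > 0"
  have less: "ky_fan f g < ky_fan f g + e / 2" "ky_fan g h < ky_fan g h + e / 2" using \<open>e > 0\<close> by simp_all
  obtain a where a: "0 \<le> a" "a < ky_fan f g + e / 2" "measure LI {s \<in> {0..<1}. \<bar>f s - g s\<bar> > a} \<le> a"
    using ky_fan_less[OF less(1)] by blast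
  obtain b where b: "0 \<le> b" "b < ky_fan g h + e / 2" "measure LI {s \<in> {0..<1}. \<bar>g s - h s\<bar> > b} \<le> b"
    using ky_fan_less[OF less(2)] by blast
  have "measure LI {s \<in> {0..<1}. \<bar>f s - h s\<bar> > a + b}
      \<le> measure LI ({s \<in> {0..<1}. \<bar>f s - g s\<bar> > a} \<union> {s \<in> {0..<1}. \<bar>g s - h s\<bar> > b})"
    using deviation_in_sets f g h by (intro LI.finite_measure_mono sets.Un) auto
  also have "\<dots> \<le> a + b"
    using measure_Un_le[OF deviation_in_sets[OF f g, of a] deviation_in_sets[OF g h, of b]] a b
    by linarith
  finally have "ky_fan f h \<le> a + b" using a b by (intro ky_fan_le) simp_all
  then show "ky_fan f h \<le> ky_fan f g + ky_fan g h + e" using a b by linarith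
qed

lemma ky_fan_comp:
  assumes \<alpha>: "measure_preserving_LI \<alpha>" and f: "f \<in> borel_measurable LI" and g: "g \<in> borel_measurable LI"
  shows "ky_fan (f \<circ> \<alpha>) (g \<circ> \<alpha>) = ky_fan f g"
proof -
  have "measure LI {s \<in> {0..<1}. \<bar>f (\<alpha> s) - g (\<alpha> s)\<bar> > \<epsilon>} = measure LI {s \<in> {0..<1}. \<bar>f s - g s\<bar> > \<epsilon>}" for \<epsilon>
  proof -
    have "\<alpha> s \<in> {0..<1}" if "s \<in> {0..<1}" for s
      using \<alpha> measurable_space[of \<alpha> LI LI s] that by (simp add: measure_preserving_LI_def)
    then have "{s \<in> {0..<1}. \<bar>f (\<alpha> s) - g (\<alpha> s)\<bar> > \<epsilon>} = \<alpha> -` {s \<in> {0..<1}. \<bar>f s - g s\<bar> > \<epsilon>} \<inter> {0..<1}"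
      by blast
    then show ?thesis using measure_preserving_vimage(2)[OF \<alpha> deviation_in_sets[OF f g]] by simp
  qed
  then show ?thesis by (simp add: ky_fan_def)
qed

lemma ky_fan_le_AE:
  assumes "0 \<le> \<epsilon>" "AE s in LI. \<bar>f s - g s\<bar> \<le> \<epsilon>"
  shows "ky_fan f g \<le> \<epsilon>"
proof (rule ky_fan_le)
  obtain N where N: "{s \<in> space LI. \<not> \<bar>f s - g s\<bar> \<le> \<epsilon>} \<subseteq> N" "emeasure LI N = 0" "N \<in> sets LI"
    by (rule AE_E[OF assms(2)])
  have "measure LI {s \<in> {0..<1}. \<bar>f s - g s\<bar> > \<epsilon>} \<le> measure LI N"
    using N(1) by (intro LI.finite_measure_mono N(3)) (simp add: not_le)
  moreover have "measure LI N = 0" using N(2) unfolding measure_def by simp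
  ultimately show "measure LI {s \<in> {0..<1}. \<bar>f s - g s\<bar> > \<epsilon>} \<le> \<epsilon>"
    using assms(1) by linarith
qed (rule assms(1))

text \<open>Infima and suprema of reals carry information only for bounded sets. The bounds are 0
  and 1, the latter because \<open>\<epsilon> = 1\<close> is always admissible in the Ky Fan
  metric.\<close>

lemma bdd_ky_fan: "bdd_below ((\<lambda>g. ky_fan f g) ` B)" "bdd_above ((\<lambda>f. INF g\<in>B. ky_fan f g) ` A)"
  if B: "B \<noteq> {}"
proof -
  show bb: "bdd_below ((\<lambda>g. ky_fan f g) ` B)" for f
    by (rule bdd_belowI[of _ 0]) (auto simp: ky_fan_nonneg)
  obtain g where "g \<in> B" using B by blast
  then have "(INF g\<in>B. ky_fan f g) \<le> 1" for f
    using cINF_lower[OF bb, of g f] ky_fan_le_1[of f g] by linarith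
  then show "bdd_above ((\<lambda>f. INF g\<in>B. ky_fan f g) ` A)"
    by (intro bdd_aboveI[of _ 1]) auto
qed

section \<open>The Hausdorff distance between sets of functions\<close>

lemma hausdorff_kf_le:
  assumes "A \<noteq> {}" "B \<noteq> {}"
    and AB: "\<And>f. f \<in> A \<Longrightarrow> \<exists>g\<in>B. ky_fan f g \<le> e" and BA: "\<And>g. g \<in> B \<Longrightarrow> \<exists>f\<in>A. ky_fan f g \<le> e"
  shows "hausdorff_kf A B \<le> e"
  unfolding hausdorff_kf_def
proof (rule max.boundedI)
  show "(SUP f\<in>A. INF g\<in>B. ky_fan f g) \<le> e"
  proof (rule cSUP_least[OF assms(1)])
    fix f assume "f \<in> A"
    then obtain g where "g \<in> B" "ky_fan f g \<le> e" using AB by blast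
    then show "(INF g\<in>B. ky_fan f g) \<le> e" by (rule cINF_lower2[OF bdd_ky_fan(1)[OF assms(2)]])
  qed
  show "(SUP g\<in>B. INF f\<in>A. ky_fan f g) \<le> e"
  proof (rule cSUP_least[OF assms(2)])
    fix g assume "g \<in> B"
    then obtain f where f: "f \<in> A" "ky_fan f g \<le> e" using BA by blast
    then have "(INF f\<in>A. ky_fan g f) \<le> e"
      unfolding ky_fan_commute[of f g] by (rule cINF_lower2[OF bdd_ky_fan(1)[OF assms(1)]])
    then show "(INF f\<in>A. ky_fan f g) \<le> e" by (subst ky_fan_commute)
  qed
qed

lemma hausdorff_kf_commute: "hausdorff_kf A B = hausdorff_kf B A"
proof -
  have *: "(SUP f\<in>A. INF g\<in>B. ky_fan f g) = (SUP f\<in>A. INF g\<in>B. ky_fan g f)" for A B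
    by (intro SUP_cong INF_cong refl ky_fan_commute)
  show ?thesis unfolding hausdorff_kf_def *[of A B] *[of B A] by (rule max.commute)
qed

lemma hausdorff_kf_less:
  assumes "B \<noteq> {}" "hausdorff_kf A B < e" "f \<in> A"
  shows "\<exists>g\<in>B. ky_fan f g < e"
proof -
  have "(INF g\<in>B. ky_fan f g) \<le> (SUP f\<in>A. INF g\<in>B. ky_fan f g)"
    using assms(3) bdd_ky_fan(2)[OF assms(1)] by (rule cSUP_upper)
  also have "\<dots> < e" using assms(2) by (simp add: hausdorff_kf_def)
  finally show ?thesis unfolding cINF_less_iff[OF assms(1) bdd_ky_fan(1)[OF assms(1)]] .
qed

lemma hausdorff_kf_nonneg:
  assumes "A \<noteq> {}" "B \<noteq> {}"
  shows "0 \<le> hausdorff_kf A B"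
proof (rule ccontr)
  assume "\<not> ?thesis"
  then have neg: "hausdorff_kf A B < 0" by simp
  obtain f where "f \<in> A" using assms(1) by blast
  then obtain g where "ky_fan f g < 0" using hausdorff_kf_less[OF assms(2) neg] by blast
  then show False using ky_fan_nonneg[of f g] by simp
qed

abbreviation observables :: "mm \<Rightarrow> (real \<Rightarrow> real) \<Rightarrow> (real \<Rightarrow> real) set" where
  "observables X \<phi> \<equiv> (\<lambda>f. f \<circ> \<phi>) ` lip1 X"

lemma zero_lip1: "mm_space X \<Longrightarrow> (\<lambda>x. 0) \<in> lip1 X"
  using Metric_space.nonneg[of "mm_set X" "mm_dist X"] unfolding lip1_def mm_space_def by simp

lemma observables_nonempty: "mm_space X \<Longrightarrow> observables X \<phi> \<noteq> {}"
  using zero_lip1[of X] by blast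

lemma observable_measurable:
  assumes "mm_space X" "parameter X \<phi>" "f \<in> observables X \<phi>"
  shows "f \<in> borel_measurable LI"
proof -
  obtain f' where f': "f' \<in> lip1 X" "f = f' \<circ> \<phi>" using assms(3) by blast
  have "\<phi> \<in> measurable LI (mm_meas X)" using assms(2) by (simp add: parameter_def)
  from measurable_comp[OF this mm.lip1_measurable[OF mm.intro[OF assms(1)] f'(1)]]
  show ?thesis unfolding f'(2) .
qed

lemma conc_le:
  assumes "mm_space X" "mm_space Y" "parameter X \<phi>" "parameter Y \<psi>"
    "hausdorff_kf (observables X \<phi>) (observables Y \<psi>) \<le> e"
  shows "conc X Y \<le> e"
proof -
  have "conc X Y \<le> hausdorff_kf (observables X \<phi>) (observables Y \<psi>)"
    unfolding conc_def
  proof (rule cInf_lower)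
    show "bdd_below {hausdorff_kf (observables X \<phi>) (observables Y \<psi>) | \<phi> \<psi>. parameter X \<phi> \<and> parameter Y \<psi>}"
      using hausdorff_kf_nonneg[OF observables_nonempty[OF assms(1)] observables_nonempty[OF assms(2)]]
      by (intro bdd_belowI[of _ 0]) blast
  qed (use assms in blast)
  with assms(5) show ?thesis by simp
qed

lemma conc_less:
  assumes "mm_space X" "mm_space Y" "conc X Y < e"
  obtains \<phi> \<psi> where "parameter X \<phi>" "parameter Y \<psi>" "hausdorff_kf (observables X \<phi>) (observables Y \<psi>) < e"
proof -
  obtain \<phi> \<psi> where "parameter X \<phi>" "parameter Y \<psi>"
    using mm.exists_parameter[OF mm.intro[OF assms(1)]] mm.exists_parameter[OF mm.intro[OF assms(2)]] by blast
  then have "hausdorff_kf (observables X \<phi>) (observables Y \<psi>)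
      \<in> {hausdorff_kf (observables X \<phi>) (observables Y \<psi>) | \<phi> \<psi>. parameter X \<phi> \<and> parameter Y \<psi>}"
    by blast
  then have "{hausdorff_kf (observables X \<phi>) (observables Y \<psi>) | \<phi> \<psi>. parameter X \<phi> \<and> parameter Y \<psi>} \<noteq> {}"
    by (metis empty_iff)
  from cInf_lessD[OF this assms(3)[unfolded conc_def]] show ?thesis using that by blast
qed

lemma conc_commute: "conc X Y = conc Y X"
proof -
  have "{hausdorff_kf (observables X \<phi>) (observables Y \<psi>) | \<phi> \<psi>. parameter X \<phi> \<and> parameter Y \<psi>}
    = {hausdorff_kf (observables Y \<psi>) (observables X \<phi>) | \<psi> \<phi>. parameter Y \<psi> \<and> parameter X \<phi>}"
    unfolding hausdorff_kf_commute[of "observables X _"] by blast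
  then show ?thesis unfolding conc_def by simp
qed

lemma observables_comp: "observables X (\<phi> \<circ> \<alpha>) = (\<lambda>f. f \<circ> \<alpha>) ` observables X \<phi>"
  by (simp add: image_image o_assoc)

text \<open>The link is a single 1-Lipschitz function \<open>g\<close> on \<open>Y\<close>, read
  once through \<open>\<psi>1\<close> after \<open>\<alpha>\<close> and once through
  \<open>\<phi>2\<close> after \<open>\<beta>\<close>. The two readings differ by at most the
  distance in \<open>Y\<close> of the points, that is by \<open>e\<close>; the remaining two steps
  of the chain are the given Hausdorff estimates, unchanged by rearrangement.\<close>

lemma conc_triangle_aux:
  assumes X: "mm_space X" and Y: "mm_space Y" and Z: "mm_space Z"
    and p: "parameter X \<phi>1" "parameter Y \<psi>1" "parameter Y \<phi>2" "parameter Z \<psi>2"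
    and h1: "hausdorff_kf (observables X \<phi>1) (observables Y \<psi>1) < a"
    and h2: "hausdorff_kf (observables Y \<phi>2) (observables Z \<psi>2) < b"
    and \<alpha>: "measure_preserving_LI \<alpha>" and \<beta>: "measure_preserving_LI \<beta>" and "0 \<le> e"
    and ae: "AE u in LI. mm_dist Y (\<psi>1 (\<alpha> u)) (\<phi>2 (\<beta> u)) \<le> e"
    and f: "f \<in> observables X (\<phi>1 \<circ> \<alpha>)"
  shows "\<exists>h\<in>observables Z (\<psi>2 \<circ> \<beta>). ky_fan f h \<le> a + e + b"
proof -
  obtain f' where f': "f' \<in> observables X \<phi>1" "f = f' \<circ> \<alpha>"
    using f unfolding observables_comp by blast
  obtain g' where g': "g' \<in> observables Y \<psi>1" "ky_fan f' g' < a"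
    using hausdorff_kf_less[OF observables_nonempty[OF Y] h1 f'(1)] by blast
  then obtain g where g: "g \<in> lip1 Y" "g' = g \<circ> \<psi>1" by blast
  obtain h' where h': "h' \<in> observables Z \<psi>2" "ky_fan (g \<circ> \<phi>2) h' < b"
    using hausdorff_kf_less[OF observables_nonempty[OF Z] h2] g(1) by blast
  have gg: "ky_fan (g \<circ> (\<psi>1 \<circ> \<alpha>)) (g \<circ> (\<phi>2 \<circ> \<beta>)) \<le> e"
  proof (rule ky_fan_le_AE[OF \<open>0 \<le> e\<close>])
    show "AE u in LI. \<bar>(g \<circ> (\<psi>1 \<circ> \<alpha>)) u - (g \<circ> (\<phi>2 \<circ> \<beta>)) u\<bar> \<le> e"
      using ae AE_space
    proof eventually_elim
      case (elim u)
      have "(\<psi>1 \<circ> \<alpha>) u \<in> mm_set Y" "(\<phi>2 \<circ> \<beta>) u \<in> mm_set Y"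
        using parameter_in[OF Y parameter_comp[OF p(2) \<alpha>], of u] parameter_in[OF Y parameter_comp[OF p(3) \<beta>], of u]
          elim(2) by simp_all
      then have "\<bar>g ((\<psi>1 \<circ> \<alpha>) u) - g ((\<phi>2 \<circ> \<beta>) u)\<bar> \<le> mm_dist Y ((\<psi>1 \<circ> \<alpha>) u) ((\<phi>2 \<circ> \<beta>) u)"
        using g(1) unfolding lip1_def by blast
      then show ?case using elim(1) by simp
    qed
  qed
  have m: "f' \<in> borel_measurable LI" "g \<circ> \<psi>1 \<in> borel_measurable LI" "g \<circ> \<phi>2 \<in> borel_measurable LI"
    "h' \<in> borel_measurable LI"
    using observable_measurable[OF X p(1) f'(1)] observable_measurable[OF Y p(2), of "g \<circ> \<psi>1"]
      observable_measurable[OF Y p(3), of "g \<circ> \<phi>2"] observable_measurable[OF Z p(4) h'(1)] g(1) by blast+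
  have "f \<in> borel_measurable LI"
    by (rule observable_measurable[OF X parameter_comp[OF p(1) \<alpha>] f])
  moreover have "g \<circ> (\<psi>1 \<circ> \<alpha>) \<in> borel_measurable LI"
    by (rule observable_measurable[OF Y parameter_comp[OF p(2) \<alpha>]]) (use g(1) in blast)
  moreover have "g \<circ> (\<phi>2 \<circ> \<beta>) \<in> borel_measurable LI"
    by (rule observable_measurable[OF Y parameter_comp[OF p(3) \<beta>]]) (use g(1) in blast)
  moreover have hin: "h' \<circ> \<beta> \<in> observables Z (\<psi>2 \<circ> \<beta>)"
    unfolding observables_comp using h'(1) by blast
  moreover have "h' \<circ> \<beta> \<in> borel_measurable LI"
    by (rule observable_measurable[OF Z parameter_comp[OF p(4) \<beta>] hin])
  ultimately have "ky_fan f (h' \<circ> \<beta>) \<le> ky_fan f (g \<circ> (\<psi>1 \<circ> \<alpha>))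
      + (ky_fan (g \<circ> (\<psi>1 \<circ> \<alpha>)) (g \<circ> (\<phi>2 \<circ> \<beta>)) + ky_fan (g \<circ> (\<phi>2 \<circ> \<beta>)) (h' \<circ> \<beta>))"
    by (intro order_trans[OF ky_fan_triangle add_left_mono[OF ky_fan_triangle]])
  moreover have "ky_fan f (g \<circ> (\<psi>1 \<circ> \<alpha>)) < a"
    using ky_fan_comp[OF \<alpha> m(1,2)] g'(2) unfolding f'(2) g(2) o_assoc by simp
  moreover have "ky_fan (g \<circ> (\<phi>2 \<circ> \<beta>)) (h' \<circ> \<beta>) < b"
    using ky_fan_comp[OF \<beta> m(3,4)] h'(2) unfolding o_assoc by simp
  ultimately have "ky_fan f (h' \<circ> \<beta>) \<le> a + e + b" using gg by linarith
  with hin show ?thesis by blast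
qed

lemma conc_triangle:
  assumes X: "mm_space X" and Y: "mm_space Y" and Z: "mm_space Z"
  shows "conc X Z \<le> conc X Y + conc Y Z"
proof (rule field_le_epsilon)
  fix e :: real assume "e > 0"
  have less: "conc X Y < conc X Y + e / 3" "conc Y Z < conc Y Z + e / 3" using \<open>e > 0\<close> by simp_all
  obtain \<phi>1 \<psi>1 where p1: "parameter X \<phi>1" "parameter Y \<psi>1"
    and h1: "hausdorff_kf (observables X \<phi>1) (observables Y \<psi>1) < conc X Y + e / 3"
    using conc_less[OF X Y less(1)] by blast
  obtain \<phi>2 \<psi>2 where p2: "parameter Y \<phi>2" "parameter Z \<psi>2"
    and h2: "hausdorff_kf (observables Y \<phi>2) (observables Z \<psi>2) < conc Y Z + e / 3"
    using conc_less[OF Y Z less(2)] by blast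
  interpret Y: mm Y using Y by (rule mm.intro)
  have e3: "e / 3 > 0" "0 \<le> e / 3" using \<open>e > 0\<close> by simp_all
  obtain \<alpha> \<beta> where \<alpha>: "measure_preserving_LI \<alpha>" and \<beta>: "measure_preserving_LI \<beta>"
    and ae: "AE u in LI. Y.d (\<psi>1 (\<alpha> u)) (\<phi>2 (\<beta> u)) \<le> e / 3"
    using Y.exists_approximate_coupling[OF p1(2) p2(1) e3(1)] by blast
  have ae': "AE u in LI. Y.d (\<phi>2 (\<beta> u)) (\<psi>1 (\<alpha> u)) \<le> e / 3"
    using ae by eventually_elim (simp add: Y.commute)
  have "hausdorff_kf (observables X (\<phi>1 \<circ> \<alpha>)) (observables Z (\<psi>2 \<circ> \<beta>)) \<le> conc X Y + conc Y Z + e"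
  proof (rule hausdorff_kf_le[OF observables_nonempty[OF X] observables_nonempty[OF Z]])
    fix f assume "f \<in> observables X (\<phi>1 \<circ> \<alpha>)"
    from conc_triangle_aux[OF X Y Z p1 p2 h1 h2 \<alpha> \<beta> e3(2) ae this]
    show "\<exists>h\<in>observables Z (\<psi>2 \<circ> \<beta>). ky_fan f h \<le> conc X Y + conc Y Z + e" by (simp add: algebra_simps)
  next
    fix h assume "h \<in> observables Z (\<psi>2 \<circ> \<beta>)"
    \<comment> \<open>The second half of the Hausdorff distance is the same chain read backwards,
      with the roles of \<open>X\<close> and \<open>Z\<close> and of \<open>\<alpha>\<close> and
      \<open>\<beta>\<close> exchanged.\<close>
    from conc_triangle_aux[OF Z Y X p2(2,1) p1(2,1) h2[unfolded hausdorff_kf_commute[of "observables Y \<phi>2"]]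
        h1[unfolded hausdorff_kf_commute[of "observables X \<phi>1"]] \<beta> \<alpha> e3(2) ae' this]
    show "\<exists>f\<in>observables X (\<phi>1 \<circ> \<alpha>). ky_fan f h \<le> conc X Y + conc Y Z + e"
      by (simp add: algebra_simps ky_fan_commute[of _ h])
  qed
  from conc_le[OF X Z parameter_comp[OF p1(1) \<alpha>] parameter_comp[OF p2(2) \<beta>] this]
  show "conc X Z \<le> conc X Y + conc Y Z + e" .
qed

text \<open>McShane extension: a 1-Lipschitz function on one space, transported along the parameters on the
  good set \<open>I0\<close>, becomes 1-Lipschitz after taking an infimal convolution with the other metric.\<close>
lemma exists_transported_lip1:
  assumes X: "mm_space X" and Y: "mm_space Y" and w: "box_witness X Y \<epsilon> \<phi> \<psi> I0" and f: "f \<in> lip1 X"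
  shows "\<exists>g\<in>lip1 Y. ky_fan (f \<circ> \<phi>) (g \<circ> \<psi>) \<le> \<epsilon>"
proof (cases "I0 = {}")
  case True
  \<comment> \<open>An empty good set has measure 0, which forces \<open>\<epsilon> \<ge> 1\<close>;
    since Ky Fan distances never exceed 1, the zero function serves. This leaves the infimum over
    \<open>I0\<close> to the nonempty case.\<close>
  then have "\<epsilon> \<ge> 1" using w by (simp add: box_witness_def)
  then have "ky_fan (f \<circ> \<phi>) ((\<lambda>x. 0) \<circ> \<psi>) \<le> \<epsilon>"
    by (rule order_trans[OF ky_fan_le_1])
  then show ?thesis using zero_lip1[OF Y] by blast
next
  case False
  interpret X: mm X using X by (rule mm.intro)
  interpret Y: mm Y using Y by (rule mm.intro)
  have p: "parameter X \<phi>" "parameter Y \<psi>" and I0: "I0 \<in> sets LI" "measure LI I0 \<ge> 1 - \<epsilon>" "0 \<le> \<epsilon>"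
    and close: "\<And>s t. s \<in> I0 \<Longrightarrow> t \<in> I0 \<Longrightarrow> \<bar>X.d (\<phi> s) (\<phi> t) - Y.d (\<psi> s) (\<psi> t)\<bar> \<le> \<epsilon>"
    using w by (simp_all add: box_witness_def)
  have I0_sub: "I0 \<subseteq> {0..<1}" using I0(1) by (simp add: sets_LI)
  have in_X: "\<phi> t \<in> X.S" and in_Y: "\<psi> t \<in> Y.S" if "t \<in> I0" for t
    using parameter_in[OF X p(1)] parameter_in[OF Y p(2)] that I0_sub by blast+
  have lip: "\<bar>f (\<phi> s) - f (\<phi> t)\<bar> \<le> X.d (\<phi> s) (\<phi> t)" if "s \<in> I0" "t \<in> I0" for s t
    using f in_X that by (simp add: lip1_def)
  define g where "g y = (INF t\<in>I0. f (\<phi> t) + Y.d y (\<psi> t))" for y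
  \<comment> \<open>This bound does two jobs: it makes the infimum defining \<open>g\<close> finite,
    and at \<open>y = \<psi> s\<close> it gives the estimate of \<open>g (\<psi> s)\<close> from
    below by \<open>f (\<phi> s) - \<epsilon>\<close>.\<close>
  have lower: "f (\<phi> s) - \<epsilon> - Y.d y (\<psi> s) \<le> f (\<phi> t) + Y.d y (\<psi> t)" if "s \<in> I0" "t \<in> I0" "y \<in> Y.S" for s t y
    using lip[OF that(1,2)] close[OF that(1,2)] Y.triangle[OF in_Y[OF that(1)] that(3) in_Y[OF that(2)]]
      Y.commute[of y "\<psi> s"] by linarith
  have bdd: "bdd_below ((\<lambda>t. f (\<phi> t) + Y.d y (\<psi> t)) ` I0)" if "y \<in> Y.S" for y
  proof -
    obtain s where "s \<in> I0" using False by blast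
    then show ?thesis using lower that by (intro bdd_belowI2[of _ "f (\<phi> s) - \<epsilon> - Y.d y (\<psi> s)"]) blast
  qed
  have g_le: "g y \<le> g y' + Y.d y y'" if y: "y \<in> Y.S" "y' \<in> Y.S" for y y'
  proof -
    have "g y - Y.d y y' \<le> g y'"
      unfolding g_def[of y']
    proof (rule cINF_greatest[OF False])
      fix t assume t: "t \<in> I0"
      have "g y \<le> f (\<phi> t) + Y.d y (\<psi> t)" unfolding g_def by (rule cINF_lower[OF bdd[OF y(1)] t])
      then show "g y - Y.d y y' \<le> f (\<phi> t) + Y.d y' (\<psi> t)" using Y.triangle[OF y in_Y[OF t]] by linarith
    qed
    then show ?thesis by simp
  qed
  have "g \<in> lip1 Y"
    unfolding lip1_def
  proof (intro CollectI ballI)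
    fix y y' assume "y \<in> Y.S" "y' \<in> Y.S"
    then show "\<bar>g y - g y'\<bar> \<le> Y.d y y'" using g_le[of y y'] g_le[of y' y] Y.commute[of y y'] by linarith
  qed
  have good: "\<bar>f (\<phi> s) - g (\<psi> s)\<bar> \<le> \<epsilon>" if s: "s \<in> I0" for s
  proof -
    have "g (\<psi> s) \<le> f (\<phi> s) + Y.d (\<psi> s) (\<psi> s)" unfolding g_def by (rule cINF_lower[OF bdd[OF in_Y[OF s]] s])
    moreover have "f (\<phi> s) - \<epsilon> - Y.d (\<psi> s) (\<psi> s) \<le> g (\<psi> s)"
      unfolding g_def by (rule cINF_greatest[OF False]) (rule lower[OF s _ in_Y[OF s]])
    ultimately show ?thesis using Y.mdist_zero[of "\<psi> s"] in_Y[OF s] I0(3) by simp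
  qed
  have "measure LI {s \<in> {0..<1}. \<bar>(f \<circ> \<phi>) s - (g \<circ> \<psi>) s\<bar> > \<epsilon>} \<le> measure LI (space LI - I0)"
  proof (rule LI.finite_measure_mono)
    show "{s \<in> {0..<1}. \<bar>(f \<circ> \<phi>) s - (g \<circ> \<psi>) s\<bar> > \<epsilon>} \<subseteq> space LI - I0"
      using good by (auto simp: not_less[symmetric])
  qed (use I0(1) in \<open>rule sets.compl_sets\<close>)
  also have "\<dots> \<le> \<epsilon>" using LI.prob_compl[OF I0(1)] I0(2) by simp
  finally have "ky_fan (f \<circ> \<phi>) (g \<circ> \<psi>) \<le> \<epsilon>" by (rule ky_fan_le[OF I0(3)])
  with \<open>g \<in> lip1 Y\<close> show ?thesis by blast
qed

text \<open>A box witness is symmetric in the two spaces, so Lipschitz functions can be transported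
  in either direction along the same parameters. This bounds both halves of the Hausdorff distance
  by the same \<open>\<epsilon>\<close>.\<close>

lemma conc_le_box_dist:
  assumes X: "mm_space X" and Y: "mm_space Y"
  shows "conc X Y \<le> box_dist X Y"
proof (rule field_le_epsilon)
  fix e :: real assume "e > 0"
  then have "box_dist X Y < box_dist X Y + e" by simp
  from box_dist_less[OF X Y this] obtain \<epsilon> \<phi> \<psi> I0 where
    \<epsilon>: "\<epsilon> < box_dist X Y + e" and w: "box_witness X Y \<epsilon> \<phi> \<psi> I0" by blast
  have w': "box_witness Y X \<epsilon> \<psi> \<phi> I0"
    using w unfolding box_witness_def by (simp add: abs_minus_commute)
  have p: "parameter X \<phi>" "parameter Y \<psi>" using w by (simp_all add: box_witness_def)
  have "hausdorff_kf (observables X \<phi>) (observables Y \<psi>) \<le> \<epsilon>"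
  proof (rule hausdorff_kf_le[OF observables_nonempty[OF X] observables_nonempty[OF Y]])
    fix f assume "f \<in> observables X \<phi>"
    then show "\<exists>g\<in>observables Y \<psi>. ky_fan f g \<le> \<epsilon>"
      using exists_transported_lip1[OF X Y w] by blast
  next
    fix g assume "g \<in> observables Y \<psi>"
    then show "\<exists>f\<in>observables X \<phi>. ky_fan f g \<le> \<epsilon>"
      unfolding ky_fan_commute[of _ g] using exists_transported_lip1[OF Y X w'] by blast
  qed
  from conc_le[OF X Y p this] \<epsilon> show "conc X Y \<le> box_dist X Y + e" by simp
qed

section \<open>Regularity of pseudometric and quotient topologies\<close>

lemma openin_dist_topology:
  "openin (dist_topology M \<delta>) U \<longleftrightarrow> U \<subseteq> M \<and> (\<forall>x\<in>U. \<exists>e>0. {y\<in>M. \<delta> x y < e} \<subseteq> U)"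
proof -
  have "istopology (\<lambda>U. U \<subseteq> M \<and> (\<forall>x\<in>U. \<exists>e>0. {y\<in>M. \<delta> x y < e} \<subseteq> U))"
    unfolding istopology_def
  proof (intro conjI allI impI)
    fix U V
    assume U: "U \<subseteq> M \<and> (\<forall>x\<in>U. \<exists>e>0. {y\<in>M. \<delta> x y < e} \<subseteq> U)"
      and V: "V \<subseteq> M \<and> (\<forall>x\<in>V. \<exists>e>0. {y\<in>M. \<delta> x y < e} \<subseteq> V)"
    show "U \<inter> V \<subseteq> M" using U by blast
    show "\<forall>x\<in>U \<inter> V. \<exists>e>0. {y\<in>M. \<delta> x y < e} \<subseteq> U \<inter> V"
    proof
      fix x assume x: "x \<in> U \<inter> V"
      obtain a where a: "a > 0" "{y\<in>M. \<delta> x y < a} \<subseteq> U" using U x by blast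
      obtain b where b: "b > 0" "{y\<in>M. \<delta> x y < b} \<subseteq> V" using V x by blast
      have "min a b > 0" using a b by simp
      moreover have "{y\<in>M. \<delta> x y < min a b} \<subseteq> U \<inter> V" using a b by auto
      ultimately show "\<exists>e>0. {y\<in>M. \<delta> x y < e} \<subseteq> U \<inter> V" by blast
    qed
  next
    fix \<K> assume K: "\<forall>K\<in>\<K>. K \<subseteq> M \<and> (\<forall>x\<in>K. \<exists>e>0. {y\<in>M. \<delta> x y < e} \<subseteq> K)"
    show "\<Union>\<K> \<subseteq> M" using K by blast
    show "\<forall>x\<in>\<Union>\<K>. \<exists>e>0. {y\<in>M. \<delta> x y < e} \<subseteq> \<Union>\<K>"
    proof
      fix x assume "x \<in> \<Union>\<K>"
      then obtain K where k: "K \<in> \<K>" "x \<in> K" by blast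
      then obtain e where "e > 0" "{y\<in>M. \<delta> x y < e} \<subseteq> K" using K by blast
      then show "\<exists>e>0. {y\<in>M. \<delta> x y < e} \<subseteq> \<Union>\<K>" using k(1) by blast
    qed
  qed
  then show ?thesis by (simp add: dist_topology_def topology_inverse')
qed

lemma topspace_dist_topology [simp]: "topspace (dist_topology M \<delta>) = M"
proof -
  have "openin (dist_topology M \<delta>) M"
    unfolding openin_dist_topology by (auto intro: exI[of _ 1])
  moreover have "U \<subseteq> M" if "openin (dist_topology M \<delta>) U" for U
    using that by (simp add: openin_dist_topology)
  ultimately show ?thesis unfolding topspace_def by blast
qed

text \<open>The ball of radius \<open>e / 2\<close> and the set of points farther than
  \<open>e / 2\<close> separate the point from the closed set. The assumptions are those of a
  pseudometric, since the argument makes no claim that distinct classes have positive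
  distance.\<close>

lemma regular_space_dist_topology:
  assumes refl: "\<And>x. x \<in> M \<Longrightarrow> \<delta> x x \<le> 0"
    and sym: "\<And>x y. x \<in> M \<Longrightarrow> y \<in> M \<Longrightarrow> \<delta> x y = \<delta> y x"
    and tri: "\<And>x y z. x \<in> M \<Longrightarrow> y \<in> M \<Longrightarrow> z \<in> M \<Longrightarrow> \<delta> x z \<le> \<delta> x y + \<delta> y z"
  shows "regular_space (dist_topology M \<delta>)"
  unfolding regular_space_def
proof (intro allI impI)
  fix C a assume H: "closedin (dist_topology M \<delta>) C \<and> a \<in> topspace (dist_topology M \<delta>) - C"
  then have a: "a \<in> M" "a \<notin> C" and C: "C \<subseteq> M" and op: "openin (dist_topology M \<delta>) (M - C)"
    by (simp_all add: closedin_def)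
  then obtain e where e: "e > 0" "{y\<in>M. \<delta> a y < e} \<subseteq> M - C"
    unfolding openin_dist_topology by blast
  let ?U = "{y\<in>M. \<delta> a y < e / 2}" and ?V = "{y\<in>M. \<delta> a y > e / 2}"
  have "openin (dist_topology M \<delta>) ?U"
    unfolding openin_dist_topology
  proof (intro conjI ballI)
    fix x assume x: "x \<in> ?U"
    have "{y\<in>M. \<delta> x y < e / 2 - \<delta> a x} \<subseteq> ?U"
    proof
      fix y assume "y \<in> {y\<in>M. \<delta> x y < e / 2 - \<delta> a x}"
      then show "y \<in> ?U" using tri[of a x y] x a(1) by simp
    qed
    moreover have "e / 2 - \<delta> a x > 0" using x by simp
    ultimately show "\<exists>r>0. {y\<in>M. \<delta> x y < r} \<subseteq> ?U" by blast
  qed blast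
  moreover have "openin (dist_topology M \<delta>) ?V"
    unfolding openin_dist_topology
  proof (intro conjI ballI)
    fix x assume x: "x \<in> ?V"
    have "{y\<in>M. \<delta> x y < \<delta> a x - e / 2} \<subseteq> ?V"
    proof
      fix y assume "y \<in> {y\<in>M. \<delta> x y < \<delta> a x - e / 2}"
      then show "y \<in> ?V" using tri[of a y x] sym[of x y] x a(1) by simp
    qed
    moreover have "\<delta> a x - e / 2 > 0" using x by simp
    ultimately show "\<exists>r>0. {y\<in>M. \<delta> x y < r} \<subseteq> ?V" by blast
  qed blast
  moreover have "a \<in> ?U" using a(1) refl[OF a(1)] e(1) by simp
  moreover have "C \<subseteq> ?V"
  proof
    fix x assume x: "x \<in> C"
    then have "\<not> \<delta> a x < e" using e(2) C by blast
    then show "x \<in> ?V" using x C e(1) by auto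
  qed
  moreover have "disjnt ?U ?V" by (auto simp: disjnt_def)
  ultimately show "\<exists>U V. openin (dist_topology M \<delta>) U \<and> openin (dist_topology M \<delta>) V \<and> a \<in> U \<and> C \<subseteq> V \<and> disjnt U V"
    by blast
qed

section \<open>Quotient topologies, slices and cones\<close>

lemma openin_quotient_topology:
  "openin (quotient_topology T q) U \<longleftrightarrow> U \<subseteq> q ` topspace T \<and> openin T {x \<in> topspace T. q x \<in> U}"
proof -
  have "istopology (\<lambda>U. U \<subseteq> q ` topspace T \<and> openin T {x \<in> topspace T. q x \<in> U})"
    unfolding istopology_def
  proof (intro conjI allI impI)
    fix U V
    assume U: "U \<subseteq> q ` topspace T \<and> openin T {x \<in> topspace T. q x \<in> U}"
      and V: "V \<subseteq> q ` topspace T \<and> openin T {x \<in> topspace T. q x \<in> V}"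
    show "U \<inter> V \<subseteq> q ` topspace T" using U by blast
    have "{x \<in> topspace T. q x \<in> U \<inter> V} = {x \<in> topspace T. q x \<in> U} \<inter> {x \<in> topspace T. q x \<in> V}" by blast
    then show "openin T {x \<in> topspace T. q x \<in> U \<inter> V}" using U V by (simp add: openin_Int)
  next
    fix \<K> assume K: "\<forall>K\<in>\<K>. K \<subseteq> q ` topspace T \<and> openin T {x \<in> topspace T. q x \<in> K}"
    show "\<Union>\<K> \<subseteq> q ` topspace T" using K by blast
    have "{x \<in> topspace T. q x \<in> \<Union>\<K>} = (\<Union>K\<in>\<K>. {x \<in> topspace T. q x \<in> K})" by blast
    moreover have "openin T (\<Union>K\<in>\<K>. {x \<in> topspace T. q x \<in> K})"
      using K by (intro openin_Union) blast
    ultimately show "openin T {x \<in> topspace T. q x \<in> \<Union>\<K>}" by simp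
  qed
  then show ?thesis by (simp add: quotient_topology_def topology_inverse')
qed

lemma topspace_quotient_topology [simp]: "topspace (quotient_topology T q) = q ` topspace T"
proof -
  have "{x \<in> topspace T. q x \<in> q ` topspace T} = topspace T" by blast
  then have "openin (quotient_topology T q) (q ` topspace T)"
    by (simp add: openin_quotient_topology)
  moreover have "U \<subseteq> q ` topspace T" if "openin (quotient_topology T q) U" for U
    using that by (simp add: openin_quotient_topology)
  ultimately show ?thesis unfolding topspace_def[of "quotient_topology T q"] by blast
qed

lemma continuous_map_quotient_topology: "continuous_map T (quotient_topology T q) q"
  unfolding continuous_map_def by (auto simp: openin_quotient_topology)

text \<open>\<open>T\<close> carries the initial topology of \<open>e\<close>, so a separation found
  in \<open>K\<close> pulls back. This is the form in which regularity passes to a slice of a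
  product or of a cone.\<close>

lemma regular_space_initial:
  assumes K: "regular_space K" and e: "continuous_map T K e"
    and op: "\<And>U. openin T U \<Longrightarrow> \<exists>W. openin K W \<and> U = {x \<in> topspace T. e x \<in> W}"
  shows "regular_space T"
  unfolding regular_space_def
proof (intro allI impI)
  fix C a assume H: "closedin T C \<and> a \<in> topspace T - C"
  then have "openin T (topspace T - C)" by blast
  from op[OF this] obtain W where W: "openin K W" "topspace T - C = {x \<in> topspace T. e x \<in> W}" by blast
  have a: "a \<in> topspace T" "e a \<in> W" using H W(2) by blast+
  have eT: "e x \<in> topspace K" if "x \<in> topspace T" for x
    using e that unfolding continuous_map_def by blast
  have "closedin K (topspace K - W)" "e a \<in> topspace K - (topspace K - W)"
    using W(1) a eT by blast+
  then obtain U V where UV: "openin K U" "openin K V" "e a \<in> U" "topspace K - W \<subseteq> V" "disjnt U V"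
    using K unfolding regular_space_def by metis
  let ?U = "{x \<in> topspace T. e x \<in> U}" and ?V = "{x \<in> topspace T. e x \<in> V}"
  have "openin T ?U" "openin T ?V"
    using UV(1,2) e openin_continuous_map_preimage by metis+
  moreover have "a \<in> ?U" using a(1) UV(3) by simp
  moreover have "C \<subseteq> ?V"
  proof
    fix x assume x: "x \<in> C"
    then have "x \<in> topspace T" using H closedin_subset by blast
    moreover have "e x \<notin> W" using W(2) x calculation by blast
    ultimately show "x \<in> ?V" using eT UV(4) by blast
  qed
  moreover have "disjnt ?U ?V" using UV(5) unfolding disjnt_def by blast
  ultimately show "\<exists>U V. openin T U \<and> openin T V \<and> a \<in> U \<and> C \<subseteq> V \<and> disjnt U V" by blast
qed

text \<open>The slice at height 1 is used: an open set \<open>U\<close> of the base is the trace on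
  it of the open set \<open>U \<times> {0<..}\<close>, which stays away from the apex.\<close>

lemma regular_space_cone_base:
  assumes "regular_space (cone_top T)"
  shows "regular_space T"
proof (rule regular_space_initial[OF assms])
  let ?R = "subtopology euclideanreal {0..}"
  let ?q = "cone_map (topspace T)"
  have "continuous_map T (prod_topology T ?R) (\<lambda>s. (s, 1))"
    by (intro continuous_map_pairedI) simp_all
  from continuous_map_compose[OF this continuous_map_quotient_topology[of _ ?q]]
  show "continuous_map T (cone_top T) (?q \<circ> (\<lambda>s. (s, 1)))"
    by (simp add: cone_top_def)
  fix U assume U: "openin T U"
  \<comment> \<open>Off the apex, \<open>cone_map\<close> sends a point to its singleton, so this is
    the image of \<open>U \<times> {0<..}\<close> in the cone.\<close>
  define W where "W = {{(s, r)} | s r. s \<in> U \<and> r > (0 :: real)}"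
  have UT: "U \<subseteq> topspace T" using openin_subset[OF U] .
  have top: "topspace (prod_topology T ?R) = topspace T \<times> {0..}" by simp
  \<comment> \<open>Over a one-point base the apex is itself a singleton; its height 0 is then what
    tells it apart from the elements of \<open>W\<close>.\<close>
  have zero: "topspace T \<times> {0 :: real} \<notin> W"
  proof
    assume "topspace T \<times> {0} \<in> W"
    then obtain s r where "topspace T \<times> {0} = {(s, r)}" "r > (0 :: real)" unfolding W_def by blast
    then show False by (metis SigmaE Pair_inject less_irrefl singletonD singletonI)
  qed
  have W_iff: "?q (s, r) \<in> W \<longleftrightarrow> s \<in> U \<and> r > 0" if "r \<ge> 0" for s and r :: real
    using zero that unfolding cone_map_def by (auto simp: W_def)
  have "W \<subseteq> ?q ` topspace (prod_topology T ?R)"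
  proof
    fix w assume "w \<in> W"
    then obtain s r where w: "w = {(s, r)}" "s \<in> U" "r > 0" unfolding W_def by blast
    then have "w = ?q (s, r)" by (simp add: cone_map_def)
    moreover have "(s, r) \<in> topspace (prod_topology T ?R)" unfolding top using w UT by auto
    ultimately show "w \<in> ?q ` topspace (prod_topology T ?R)" by blast
  qed
  moreover have "{x \<in> topspace (prod_topology T ?R). ?q x \<in> W} = U \<times> {0<..}"
    unfolding top using W_iff UT by force
  moreover have "openin (prod_topology T ?R) (U \<times> {0<..})"
  proof -
    have "openin ?R {0<..}"
      unfolding openin_subtopology by (rule exI[of _ "{0<..}"]) auto
    then show ?thesis using U by (simp add: openin_prod_Times_iff)
  qed
  ultimately have "openin (cone_top T) W"
    unfolding cone_top_def openin_quotient_topology by simp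
  moreover have "U = {x \<in> topspace T. (?q \<circ> (\<lambda>s. (s, 1))) x \<in> W}"
    using W_iff[of 1] UT by auto
  ultimately show "\<exists>W. openin (cone_top T) W \<and> U = {x \<in> topspace T. (?q \<circ> (\<lambda>s. (s, 1))) x \<in> W}"
    by blast
qed

lemma regular_space_prod_factor:
  assumes "regular_space (prod_topology S T)" "topspace S \<noteq> {}"
  shows "regular_space T"
proof -
  obtain c where c: "c \<in> topspace S" using assms(2) by blast
  show ?thesis
  proof (rule regular_space_initial[OF assms(1)])
    show "continuous_map T (prod_topology S T) (\<lambda>s. (c, s))"
      using c by (intro continuous_map_pairedI) simp_all
    fix U assume U: "openin T U"
    have "openin (prod_topology S T) (topspace S \<times> U)" using U by (simp add: openin_prod_Times_iff)
    moreover have "U = {x \<in> topspace T. (c, x) \<in> topspace S \<times> U}" using c openin_subset[OF U] by blast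
    ultimately show "\<exists>W. openin (prod_topology S T) W \<and> U = {x \<in> topspace T. (c, x) \<in> W}" by blast
  qed
qed

section \<open>Isomorphism classes and orbits\<close>

lemma mm_scale_simps [simp]:
  "mm_set (mm_scale t X) = mm_set X" "mm_dist (mm_scale t X) x y = t * mm_dist X x y"
  "mm_meas (mm_scale t X) = mm_meas X"
  by (simp_all add: mm_scale_def mm_set_def mm_dist_def mm_meas_def)

lemma mm_scale_scale: "mm_scale s (mm_scale t X) = mm_scale (s * t) X"
  by (simp add: mm_scale_def mm_set_def mm_dist_def mm_meas_def mult.assoc)

lemma mm_scale_1: "mm_scale 1 X = X"
  by (simp add: mm_scale_def mm_set_def mm_dist_def mm_meas_def)

lemma mm_iso_refl:
  assumes "mm_space X"
  shows "mm_iso X X"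
  unfolding mm_iso_def
  by (rule exI[of _ "\<lambda>x. x"]) (use distr_id2[of "mm_meas X" "mm_meas X"] in \<open>auto simp: bij_betw_def\<close>)

lemma mm_iso_trans:
  assumes "mm_iso X Y" "mm_iso Y Z"
  shows "mm_iso X Z"
proof -
  obtain f where f: "bij_betw f (mm_set X) (mm_set Y)"
    "\<forall>x\<in>mm_set X. \<forall>y\<in>mm_set X. mm_dist Y (f x) (f y) = mm_dist X x y"
    "f \<in> measurable (mm_meas X) (mm_meas Y)" "distr (mm_meas X) (mm_meas Y) f = mm_meas Y"
    using assms(1) unfolding mm_iso_def by blast
  obtain g where g: "bij_betw g (mm_set Y) (mm_set Z)"
    "\<forall>x\<in>mm_set Y. \<forall>y\<in>mm_set Y. mm_dist Z (g x) (g y) = mm_dist Y x y"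
    "g \<in> measurable (mm_meas Y) (mm_meas Z)" "distr (mm_meas Y) (mm_meas Z) g = mm_meas Z"
    using assms(2) unfolding mm_iso_def by blast
  have fY: "f x \<in> mm_set Y" if "x \<in> mm_set X" for x using f(1) that by (rule bij_betwE[rule_format])
  have "bij_betw (g \<circ> f) (mm_set X) (mm_set Z)" using f(1) g(1) by (rule bij_betw_trans)
  moreover have "\<forall>x\<in>mm_set X. \<forall>y\<in>mm_set X. mm_dist Z ((g \<circ> f) x) ((g \<circ> f) y) = mm_dist X x y"
    using f(2) g(2) fY by simp
  moreover have "g \<circ> f \<in> measurable (mm_meas X) (mm_meas Z)" using f(3) g(3) by (rule measurable_comp)
  moreover have "distr (mm_meas X) (mm_meas Z) (g \<circ> f) = mm_meas Z"
    using distr_distr[OF g(3) f(3)] unfolding f(4) g(4) by (rule sym)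
  ultimately show ?thesis unfolding mm_iso_def by blast
qed

lemma mm_iso_scale:
  assumes "mm_iso X Y"
  shows "mm_iso (mm_scale t X) (mm_scale t Y)"
  using assms unfolding mm_iso_def mm_scale_simps by (metis (no_types, lifting))

lemma mm_class_self: "mm_space X \<Longrightarrow> X \<in> mm_class X"
  by (simp add: mm_class_def mm_iso_refl)

lemma mm_rep_class:
  assumes "mm_space X"
  shows "mm_space (mm_rep (mm_class X))" "mm_iso X (mm_rep (mm_class X))"
proof -
  have "mm_rep (mm_class X) \<in> mm_class X"
    unfolding mm_rep_def using mm_class_self[OF assms] by (rule someI)
  then show "mm_space (mm_rep (mm_class X))" "mm_iso X (mm_rep (mm_class X))"
    by (simp_all add: mm_class_def)
qed

lemma mm_space_rep: "A \<in> XX \<Longrightarrow> mm_space (mm_rep A)"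
  unfolding XX_def using mm_rep_class(1) by blast

lemma mm_class_in_XX: "mm_space X \<Longrightarrow> mm_class X \<in> XX"
  unfolding XX_def by blast

lemma scale_mm_class:
  assumes "mm_space X"
  shows "scale_class t (mm_class X) = mm_class (mm_scale t X)"
proof (intro equalityI subsetI)
  fix Y assume "Y \<in> scale_class t (mm_class X)"
  then obtain X' where "mm_space Y" "mm_iso X X'" "mm_iso (mm_scale t X') Y"
    unfolding scale_class_def mm_class_def by blast
  then show "Y \<in> mm_class (mm_scale t X)"
    using mm_iso_trans[OF mm_iso_scale] unfolding mm_class_def by blast
next
  fix Y assume "Y \<in> mm_class (mm_scale t X)"
  then show "Y \<in> scale_class t (mm_class X)"
    using mm_class_self[OF assms] unfolding scale_class_def mm_class_def by blast
qed

lemma orbit_mm_class: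
  assumes "mm_space X"
  shows "orbit (mm_class X) = {mm_class (mm_scale t X) | t. t > 0}"
  unfolding orbit_def scale_mm_class[OF assms] ..

lemma mm_class_in_orbit:
  assumes "A \<in> XX"
  shows "A \<in> orbit A"
proof -
  obtain X where X: "mm_space X" "A = mm_class X" using assms unfolding XX_def by blast
  have "A = mm_class (mm_scale 1 X)" using X(2) by (simp add: mm_scale_1)
  then show ?thesis unfolding X(2) orbit_mm_class[OF X(1)] using zero_less_one by blast
qed

lemma orbit_scale:
  assumes "mm_space X" "mm_space (mm_scale t X)" "t > 0"
  shows "orbit (mm_class (mm_scale t X)) = orbit (mm_class X)"
proof (intro equalityI subsetI)
  fix A assume "A \<in> orbit (mm_class (mm_scale t X))"
  then obtain s where s: "s > 0" "A = mm_class (mm_scale (s * t) X)"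
    unfolding orbit_mm_class[OF assms(2)] mm_scale_scale by blast
  moreover have "s * t > 0" using s(1) assms(3) by simp
  ultimately show "A \<in> orbit (mm_class X)" unfolding orbit_mm_class[OF assms(1)] by blast
next
  fix A assume "A \<in> orbit (mm_class X)"
  then obtain s where s: "s > 0" "A = mm_class (mm_scale s X)"
    unfolding orbit_mm_class[OF assms(1)] by blast
  then have "A = mm_class (mm_scale ((s / t) * t) X)" "s / t > 0" using assms(3) by simp_all
  then show "A \<in> orbit (mm_class (mm_scale t X))"
    unfolding orbit_mm_class[OF assms(2)] mm_scale_scale by blast
qed

text \<open>Composing a parameter with the isometry gives a parameter of the second space, and with
  the whole interval as good set the discrepancy is 0.\<close>

lemma box_dist_iso:
  assumes X: "mm_space X" and iso: "mm_iso X Y"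
  shows "box_dist X Y \<le> 0"
proof -
  obtain f where f: "bij_betw f (mm_set X) (mm_set Y)"
    "\<forall>x\<in>mm_set X. \<forall>y\<in>mm_set X. mm_dist Y (f x) (f y) = mm_dist X x y"
    "f \<in> measurable (mm_meas X) (mm_meas Y)" "distr (mm_meas X) (mm_meas Y) f = mm_meas Y"
    using iso unfolding mm_iso_def by blast
  obtain \<phi> where \<phi>: "parameter X \<phi>" using mm.exists_parameter[OF mm.intro[OF X]] by blast
  then have \<phi>': "\<phi> \<in> measurable LI (mm_meas X)" "distr LI (mm_meas X) \<phi> = mm_meas X"
    by (simp_all add: parameter_def)
  have "parameter Y (f \<circ> \<phi>)"
    using measurable_comp[OF \<phi>'(1) f(3)] distr_distr[OF f(3) \<phi>'(1)]
    unfolding parameter_def \<phi>'(2) f(4) by simp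
  moreover have "{0..<1} \<in> sets LI" by (simp add: sets_LI)
  moreover have "measure LI {0..<1} = 1" using LI.prob_space by simp
  ultimately have "box_witness X Y 0 \<phi> (f \<circ> \<phi>) {0..<1}"
    using \<phi> f(2) parameter_in[OF X \<phi>] unfolding box_witness_def by simp
  then show ?thesis by (rule box_dist_le)
qed

text \<open>The common interface of the two distances: estimates from above are made with
  \<open>box_dist\<close>, and neighbourhoods are shown to be small enough with \<open>conc\<close>.
  Everything on \<open>\<Sigma>\<close> is proved here once.\<close>

locale mm_distance =
  fixes \<delta> :: "mm \<Rightarrow> mm \<Rightarrow> real"
  assumes commute: "\<delta> X Y = \<delta> Y X"
    and triangle: "\<lbrakk>mm_space X; mm_space Y; mm_space Z\<rbrakk> \<Longrightarrow> \<delta> X Z \<le> \<delta> X Y + \<delta> Y Z"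
    and le_box_dist: "\<lbrakk>mm_space X; mm_space Y\<rbrakk> \<Longrightarrow> \<delta> X Y \<le> box_dist X Y"
    and conc_le_dist: "\<lbrakk>mm_space X; mm_space Y\<rbrakk> \<Longrightarrow> conc X Y \<le> \<delta> X Y"

lemma mm_distance_box_dist: "mm_distance box_dist"
  by standard (simp_all add: box_dist_commute box_dist_triangle conc_le_box_dist)

lemma mm_distance_conc: "mm_distance conc"
  by standard (simp_all add: conc_commute conc_triangle conc_le_box_dist)

context mm_distance
begin

lemma iso_le_0: "\<lbrakk>mm_space X; mm_space Y; mm_iso X Y\<rbrakk> \<Longrightarrow> \<delta> X Y \<le> 0"
  using le_box_dist box_dist_iso order_trans by blast

text \<open>Open sets of \<open>XX_top\<close> are defined through chosen representatives. A
  representative is isomorphic to the space at hand, so passing to it costs distance 0.\<close>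

lemma rep_le:
  assumes X: "mm_space X" and Y: "mm_space Y"
  shows "\<delta> (mm_rep (mm_class X)) (mm_rep (mm_class Y)) \<le> box_dist X Y"
proof -
  note rX = mm_rep_class[OF X] and rY = mm_rep_class[OF Y]
  have "\<delta> X (mm_rep (mm_class X)) \<le> 0" "\<delta> Y (mm_rep (mm_class Y)) \<le> 0"
    using iso_le_0[OF X rX] iso_le_0[OF Y rY] by simp_all
  moreover have "\<delta> (mm_rep (mm_class X)) (mm_rep (mm_class Y))
      \<le> \<delta> (mm_rep (mm_class X)) X + (\<delta> X Y + \<delta> Y (mm_rep (mm_class Y)))"
    using triangle[OF rX(1) X rY(1)] triangle[OF X Y rY(1)] by linarith
  ultimately show ?thesis
    using le_box_dist[OF X Y] commute[of "mm_rep (mm_class X)" X] by linarith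
qed

lemma regular_XX: "regular_space (XX_top \<delta>)"
  unfolding XX_top_def
proof (rule regular_space_dist_topology)
  fix A assume "A \<in> XX"
  then show "\<delta> (mm_rep A) (mm_rep A) \<le> 0"
    using iso_le_0[OF _ _ mm_iso_refl] mm_space_rep by blast
qed (simp_all add: commute triangle mm_space_rep)

end

section \<open>An open scale-invariant property\<close>

text \<open>This says that the observable diameter of \<open>X\<close>, with \<open>1/4\<close> of the mass discarded at either end,
  is positive.\<close>
definition separates :: "mm \<Rightarrow> bool" where
  "separates X \<longleftrightarrow> (\<exists>f\<in>lip1 X. \<exists>c c'. c < c'
    \<and> measure (mm_meas X) {x \<in> mm_set X. f x \<le> c} > 1 / 4
    \<and> measure (mm_meas X) {x \<in> mm_set X. c' \<le> f x} > 1 / 4)"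

lemma separates_scale:
  assumes "separates X" "t > 0"
  shows "separates (mm_scale t X)"
proof -
  obtain f c c' where f: "f \<in> lip1 X" "c < c'" "measure (mm_meas X) {x \<in> mm_set X. f x \<le> c} > 1 / 4"
    "measure (mm_meas X) {x \<in> mm_set X. c' \<le> f x} > 1 / 4"
    using assms(1) unfolding separates_def by blast
  have "\<bar>t * a - t * b\<bar> = t * \<bar>a - b\<bar>" for a b
    using assms(2) abs_mult[of t "a - b"] unfolding right_diff_distrib by simp
  then have lip: "(\<lambda>x. t * f x) \<in> lip1 (mm_scale t X)"
    using f(1) assms(2) by (simp add: lip1_def mult_left_mono)
  have sets: "{x \<in> mm_set X. t * f x \<le> t * c} = {x \<in> mm_set X. f x \<le> c}"
    "{x \<in> mm_set X. t * c' \<le> t * f x} = {x \<in> mm_set X. c' \<le> f x}"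
    using assms(2) by simp_all
  show ?thesis
    unfolding separates_def mm_scale_simps
  proof (intro bexI[OF _ lip] exI conjI)
    show "t * c < t * c'" using f(2) assms(2) by simp
  qed (unfold sets, use f(3,4) in simp_all)
qed

lemma superlevel_sets:
  assumes "mm_space X" "f \<in> lip1 X"
  shows "{x \<in> mm_set X. f x \<le> c} \<in> sets (mm_meas X)" "{x \<in> mm_set X. c \<le> f x} \<in> sets (mm_meas X)"
proof -
  interpret mm X using assms(1) by (rule mm.intro)
  note m = lip1_measurable[OF assms(2)]
  have "{x \<in> space \<mu>. f x \<le> c} \<in> sets \<mu>" "{x \<in> space \<mu>. c \<le> f x} \<in> sets \<mu>"
    by (rule borel_measurable_le[OF m borel_measurable_const])
      (rule borel_measurable_le[OF borel_measurable_const m])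
  then show "{x \<in> S. f x \<le> c} \<in> sets \<mu>" "{x \<in> S. c \<le> f x} \<in> sets \<mu>" by simp_all
qed

text \<open>On the side of \<open>X\<close> only \<open>space (mm_meas X) = mm_set X\<close> is
  asked for, because the lemma is applied to scaled spaces \<open>mm_scale t Z\<close> that have not
  been shown to be mm-spaces.\<close>

lemma separates_iso:
  assumes Y: "mm_space Y" and X: "space (mm_meas X) = mm_set X" and iso: "mm_iso X Y"
  shows "separates X \<longleftrightarrow> separates Y"
proof -
  obtain f where f: "bij_betw f (mm_set X) (mm_set Y)"
    and df: "\<forall>x\<in>mm_set X. \<forall>y\<in>mm_set X. mm_dist Y (f x) (f y) = mm_dist X x y"
    and mf: "f \<in> measurable (mm_meas X) (mm_meas Y)" and law: "distr (mm_meas X) (mm_meas Y) f = mm_meas Y"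
    using iso unfolding mm_iso_def by blast
  have fY: "f x \<in> mm_set Y" if "x \<in> mm_set X" for x using f(1) that by (rule bij_betwE[rule_format])
  have pull: "measure (mm_meas Y) {y \<in> mm_set Y. P y} = measure (mm_meas X) {x \<in> mm_set X. P (f x)}"
    if "{y \<in> mm_set Y. P y} \<in> sets (mm_meas Y)" for P
  proof -
    have "measure (mm_meas Y) {y \<in> mm_set Y. P y}
        = measure (mm_meas X) (f -` {y \<in> mm_set Y. P y} \<inter> space (mm_meas X))"
      using measure_distr[OF mf that] unfolding law .
    also have "f -` {y \<in> mm_set Y. P y} \<inter> space (mm_meas X) = {x \<in> mm_set X. P (f x)}"
      unfolding X using fY by blast
    finally show ?thesis .
  qed
  show ?thesis
  proof
    assume "separates Y"
    then obtain g c c' where g: "g \<in> lip1 Y" "c < c'" "measure (mm_meas Y) {x \<in> mm_set Y. g x \<le> c} > 1 / 4"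
      "measure (mm_meas Y) {x \<in> mm_set Y. c' \<le> g x} > 1 / 4"
      unfolding separates_def by blast
    have lip: "(\<lambda>x. g (f x)) \<in> lip1 X"
      unfolding lip1_def
    proof (intro CollectI ballI)
      fix x y assume xy: "x \<in> mm_set X" "y \<in> mm_set X"
      have "\<bar>g (f x) - g (f y)\<bar> \<le> mm_dist Y (f x) (f y)"
        using g(1) fY[OF xy(1)] fY[OF xy(2)] by (simp add: lip1_def)
      then show "\<bar>g (f x) - g (f y)\<bar> \<le> mm_dist X x y" using df xy by simp
    qed
    show "separates X"
      unfolding separates_def
    proof (intro bexI[OF _ lip] exI conjI)
      show "c < c'" by (rule g(2))
    qed (use g(3,4) in \<open>unfold pull[OF superlevel_sets(1)[OF Y g(1)]] pull[OF superlevel_sets(2)[OF Y g(1)]]\<close>)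
  next
    assume "separates X"
    then obtain g c c' where g: "g \<in> lip1 X" "c < c'" "measure (mm_meas X) {x \<in> mm_set X. g x \<le> c} > 1 / 4"
      "measure (mm_meas X) {x \<in> mm_set X. c' \<le> g x} > 1 / 4"
      unfolding separates_def by blast
    \<comment> \<open>The level sets of \<open>h\<close> are measurable in \<open>Y\<close> because
      \<open>h\<close> is 1-Lipschitz there; \<open>pull\<close> then turns their measures into
      those of the level sets of \<open>g\<close>.\<close>
    define h where "h y = g (inv_into (mm_set X) f y)" for y
    have hf: "h (f x) = g x" if "x \<in> mm_set X" for x
      using bij_betw_inv_into_left[OF f that] by (simp add: h_def)
    have lip: "h \<in> lip1 Y"
      unfolding lip1_def
    proof (intro CollectI ballI)
      fix y z assume "y \<in> mm_set Y" "z \<in> mm_set Y"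
      then obtain x w where "x \<in> mm_set X" "y = f x" "w \<in> mm_set X" "z = f w"
        using f unfolding bij_betw_def by blast
      then show "\<bar>h y - h z\<bar> \<le> mm_dist Y y z" using g(1) df hf unfolding lip1_def by simp
    qed
    have sets: "{x \<in> mm_set X. g x \<le> c} = {x \<in> mm_set X. h (f x) \<le> c}"
      "{x \<in> mm_set X. c' \<le> g x} = {x \<in> mm_set X. c' \<le> h (f x)}"
      using hf by auto
    show "separates Y"
      unfolding separates_def
    proof (intro bexI[OF _ lip] exI conjI)
      show "c < c'" by (rule g(2))
    qed (unfold pull[OF superlevel_sets(1)[OF Y lip]] pull[OF superlevel_sets(2)[OF Y lip]],
        use g(3,4) sets in simp_all)
  qed
qed

lemma parameter_measure:
  assumes "mm_space X" "parameter X \<phi>" "{x \<in> mm_set X. P x} \<in> sets (mm_meas X)"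
  shows "measure (mm_meas X) {x \<in> mm_set X. P x} = measure LI {s \<in> {0..<1}. P (\<phi> s)}"
    "{s \<in> {0..<1}. P (\<phi> s)} \<in> sets LI"
proof -
  have p: "\<phi> \<in> measurable LI (mm_meas X)" "distr LI (mm_meas X) \<phi> = mm_meas X"
    using assms(2) by (simp_all add: parameter_def)
  have eq: "\<phi> -` {x \<in> mm_set X. P x} \<inter> space LI = {s \<in> {0..<1}. P (\<phi> s)}"
    using parameter_in[OF assms(1,2)] by auto
  show "measure (mm_meas X) {x \<in> mm_set X. P x} = measure LI {s \<in> {0..<1}. P (\<phi> s)}"
    using measure_distr[OF p(1) assms(3)] unfolding p(2) eq .
  show "{s \<in> {0..<1}. P (\<phi> s)} \<in> sets LI"
    using measurable_sets[OF p(1) assms(3)] unfolding eq .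
qed

text \<open>All inequalities in \<open>separates\<close> are strict, so they leave room. A nearby
  space has a 1-Lipschitz \<open>g\<close> that agrees with \<open>f\<close> up to
  \<open>\<epsilon>\<close> outside a set of measure \<open>\<epsilon>\<close>, after both are read
  on the unit interval.\<close>

lemma separates_conc_open:
  assumes X: "mm_space X" and sep: "separates X"
  shows "\<exists>e>0. \<forall>Y. mm_space Y \<longrightarrow> conc X Y < e \<longrightarrow> separates Y"
proof -
  obtain f c c' where f: "f \<in> lip1 X" "c < c'" and
    m: "measure (mm_meas X) {x \<in> mm_set X. f x \<le> c} > 1 / 4" (is "?m1 > _")
      "measure (mm_meas X) {x \<in> mm_set X. c' \<le> f x} > 1 / 4" (is "?m2 > _")
    using sep unfolding separates_def by blast
  \<comment> \<open>Both thresholds move inward by \<open>\<epsilon>\<close>, which uses up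
    \<open>2 * \<epsilon>\<close> of the gap \<open>c' - c\<close>, and each mass drops by at most
    \<open>\<epsilon>\<close>, which must stay below its surplus over 1/4.\<close>
  define e where "e = min ((c' - c) / 2) (min (?m1 - 1 / 4) (?m2 - 1 / 4))"
  have "separates Y" if Y: "mm_space Y" and d: "conc X Y < e" for Y
  proof -
    obtain \<phi> \<psi> where \<phi>: "parameter X \<phi>" and \<psi>: "parameter Y \<psi>"
      and h: "hausdorff_kf (observables X \<phi>) (observables Y \<psi>) < e"
      using conc_less[OF X Y d] by blast
    obtain g where g: "g \<in> lip1 Y" "ky_fan (f \<circ> \<phi>) (g \<circ> \<psi>) < e"
      using hausdorff_kf_less[OF observables_nonempty[OF Y] h] f(1) by blast
    obtain \<epsilon> where \<epsilon>: "0 \<le> \<epsilon>" "\<epsilon> < e"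
      and D: "measure LI {s \<in> {0..<1}. \<bar>(f \<circ> \<phi>) s - (g \<circ> \<psi>) s\<bar> > \<epsilon>} \<le> \<epsilon>" (is "measure LI ?D \<le> _")
      using ky_fan_less[OF g(2)] by blast
    have Dm: "?D \<in> sets LI"
      using observable_measurable[OF X \<phi>, of "f \<circ> \<phi>"] observable_measurable[OF Y \<psi>, of "g \<circ> \<psi>"] f(1) g(1)
      by (intro deviation_in_sets) blast+
    have sub: "measure LI A \<le> measure LI B + \<epsilon>" if "A \<subseteq> B \<union> ?D" "B \<in> sets LI" for A B
    proof -
      have "measure LI A \<le> measure LI (B \<union> ?D)"
        using that Dm by (intro LI.finite_measure_mono sets.Un)
      also have "\<dots> \<le> measure LI B + measure LI ?D" using that(2) Dm by (rule measure_Un_le)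
      finally show ?thesis using D by linarith
    qed
    note f1 = parameter_measure[OF X \<phi> superlevel_sets(1)[OF X f(1), of c]]
      and f2 = parameter_measure[OF X \<phi> superlevel_sets(2)[OF X f(1), of c']]
      and g1 = parameter_measure[OF Y \<psi> superlevel_sets(1)[OF Y g(1), of "c + \<epsilon>"]]
      and g2 = parameter_measure[OF Y \<psi> superlevel_sets(2)[OF Y g(1), of "c' - \<epsilon>"]]
    have "{s \<in> {0..<1}. f (\<phi> s) \<le> c} \<subseteq> {s \<in> {0..<1}. g (\<psi> s) \<le> c + \<epsilon>} \<union> ?D"
      "{s \<in> {0..<1}. c' \<le> f (\<phi> s)} \<subseteq> {s \<in> {0..<1}. c' - \<epsilon> \<le> g (\<psi> s)} \<union> ?D"
      by auto
    from sub[OF this(1) g1(2)] sub[OF this(2) g2(2)]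
    have bd: "?m1 \<le> measure (mm_meas Y) {x \<in> mm_set Y. g x \<le> c + \<epsilon>} + \<epsilon>"
      "?m2 \<le> measure (mm_meas Y) {x \<in> mm_set Y. c' - \<epsilon> \<le> g x} + \<epsilon>"
      unfolding f1(1) f2(1) g1(1) g2(1) .
    have small: "\<epsilon> < (c' - c) / 2" "\<epsilon> < ?m1 - 1 / 4" "\<epsilon> < ?m2 - 1 / 4"
      using \<epsilon>(2) unfolding e_def by simp_all
    have m': "measure (mm_meas Y) {x \<in> mm_set Y. g x \<le> c + \<epsilon>} > 1 / 4"
      using bd(1) small(2) by linarith
    have m'': "measure (mm_meas Y) {x \<in> mm_set Y. c' - \<epsilon> \<le> g x} > 1 / 4"
      using bd(2) small(3) by linarith
    have "c + \<epsilon> < c' - \<epsilon>" using small(1) by (simp add: field_simps)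
    then show ?thesis using g(1) m' m'' unfolding separates_def by blast
  qed
  moreover have "e > 0" using f(2) m unfolding e_def by simp
  ultimately show ?thesis by blast
qed

text \<open>The property travels from the representative of \<open>B\<close> to an arbitrary member
  \<open>Z\<close> by isomorphism, from \<open>Z\<close> to its multiple by scaling, and from there
  to the representative of \<open>A\<close> by isomorphism again.\<close>

lemma separates_orbit:
  assumes A: "A \<in> XX" and B: "B \<in> XX" and orb: "orbit A = orbit B" and sep: "separates (mm_rep B)"
  shows "separates (mm_rep A)"
proof -
  obtain Z where Z: "mm_space Z" "B = mm_class Z" using B unfolding XX_def by blast
  obtain t where t: "t > 0" "A = mm_class (mm_scale t Z)"
    using mm_class_in_orbit[OF A] unfolding orb Z(2) orbit_mm_class[OF Z(1)] by blast
  obtain V where V: "mm_space V" "A = mm_class V" using A unfolding XX_def by blast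
  have "mm_rep A \<in> A" unfolding mm_rep_def using mm_class_self[OF V(1)] unfolding V(2) by (rule someI)
  then have rA: "mm_space (mm_rep A)" "mm_iso (mm_scale t Z) (mm_rep A)"
    unfolding t(2) by (simp_all add: mm_class_def)
  have sp: "space (mm_meas Z) = mm_set Z" using Z(1) by (simp add: mm_space_def)
  have "separates Z"
    using separates_iso[OF mm_rep_class(1)[OF Z(1)] sp mm_rep_class(2)[OF Z(1)]] sep unfolding Z(2) by simp
  from separates_scale[OF this t(1)] show ?thesis
    using separates_iso[OF rA(1) _ rA(2)] sp by simp
qed

section \<open>Finite spaces\<close>

text \<open>The measure is defined as the image of Lebesgue measure under \<open>\<phi>\<close>,
  which makes \<open>\<phi>\<close> a parameter by construction. Box witnesses between finite spaces
  can then be written down as step functions.\<close>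

definition step_mm :: "real set \<Rightarrow> (real \<Rightarrow> real \<Rightarrow> real) \<Rightarrow> (real \<Rightarrow> real) \<Rightarrow> mm" where
  "step_mm S d \<phi> = (S, d, distr LI (count_space S) \<phi>)"

lemma step_mm_simps [simp]:
  "mm_set (step_mm S d \<phi>) = S" "mm_dist (step_mm S d \<phi>) = d"
  "mm_meas (step_mm S d \<phi>) = distr LI (count_space S) \<phi>"
  by (simp_all add: step_mm_def mm_set_def mm_dist_def mm_meas_def)

lemma scale_step_mm: "mm_scale t (step_mm S d \<phi>) = step_mm S (\<lambda>x y. t * d x y) \<phi>"
  by (simp add: step_mm_def mm_scale_def mm_set_def mm_dist_def mm_meas_def)

text \<open>A finite metric space is discrete, hence compact and so complete, and all its subsets
  are Borel. Full support amounts to every point having positive mass.\<close>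

lemma mm_space_step_mm:
  assumes "finite S" "Metric_space S d" and \<phi>: "\<phi> \<in> measurable LI (count_space S)"
    and pos: "\<And>x. x \<in> S \<Longrightarrow> measure LI (\<phi> -` {x} \<inter> {0..<1}) > 0"
  shows "mm_space (step_mm S d \<phi>)"
proof -
  interpret Metric_space S d by fact
  have top: "mtopology = discrete_topology S"
    using assms(1) Hausdorff_space_mtopology by (intro finite_topspace_imp_discrete_topology) simp_all
  have complete: mcomplete
    using assms(1) by (intro compact_space_imp_mcomplete) (simp add: top compact_space_discrete_topology)
  have separable: "separable_space mtopology"
    using assms(1) unfolding top separable_space_discrete_topology by (rule countable_finite)
  have "sigma_sets S (Pow S) = Pow S"
    using sigma_algebra.sigma_sets_eq[OF sigma_algebra_Pow] .
  moreover have "{U. openin mtopology U} = Pow S" unfolding top by auto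
  ultimately have borel: "borel_sets_of mtopology = Pow S" by (simp add: borel_sets_of_def)
  have pos': "emeasure (distr LI (count_space S) \<phi>) U > 0" if "x \<in> S" "openin mtopology U" "x \<in> U" for x U
  proof -
    have U: "U \<in> sets (count_space S)" using openin_subset[OF that(2)] by simp
    have "0 < measure LI (\<phi> -` {x} \<inter> space LI)" using pos[OF that(1)] by simp
    also have "\<dots> \<le> measure LI (\<phi> -` U \<inter> space LI)"
      using measurable_sets[OF \<phi> U] that(3) by (intro LI.finite_measure_mono) auto
    finally show ?thesis
      using emeasure_distr[OF \<phi> U] by (simp add: LI.emeasure_eq_measure)
  qed
  have "prob_space (distr LI (count_space S) \<phi>)" using \<phi> by (rule LI.prob_space_distr)
  then show ?thesis
    unfolding mm_space_def mm_top_def step_mm_simps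
    using complete separable borel pos' assms(2) by simp
qed

lemma parameter_step_mm:
  assumes "\<phi> \<in> measurable LI (count_space S)"
  shows "parameter (step_mm S d \<phi>) \<phi>"
proof -
  have "\<phi> \<in> measurable LI (distr LI (count_space S) \<phi>)"
    using assms measurable_cong_sets[OF refl sets_distr] by blast
  moreover have "distr LI (distr LI (count_space S) \<phi>) \<phi> = distr LI (count_space S) \<phi>"
    by (rule distr_cong) simp_all
  ultimately show ?thesis by (simp add: parameter_def)
qed

lemma measurable_step:
  assumes "\<And>s. s \<in> {0..<1} \<Longrightarrow> \<phi> s \<in> S" "countable S" "\<And>x. x \<in> S \<Longrightarrow> \<phi> -` {x} \<inter> {0..<1} \<in> sets borel"
  shows "\<phi> \<in> measurable LI (count_space S)"
  using assms by (intro measurable_count_space_eq_countable[THEN iffD2] conjI ballI)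
    (auto simp: sets_LI)

lemma measure_LI_interval:
  assumes "0 \<le> a" "a \<le> b" "b \<le> 1"
  shows "measure LI {a..<b} = b - a"
proof -
  have "emeasure LI {a..<b} = emeasure lborel {a..<b}"
    using assms unfolding LI_def by (intro emeasure_restrict_space) auto
  then show ?thesis using assms by (simp add: measure_def)
qed

section \<open>The two-point and three-point examples\<close>

definition two_dist :: "real \<Rightarrow> real \<Rightarrow> real" where
  "two_dist x y = (if x = y then 0 else 1)"

definition two_step :: "real \<Rightarrow> real \<Rightarrow> real" where
  "two_step a s = (if s < 1 - a then 0 else 2)"

text \<open>The points are called 0 and 2 so that 2 is the atom of mass \<open>a\<close> both here
  and in \<open>three_point\<close>; the latter splits the point 0 into 0 and 1.\<close>

definition two_point :: "real \<Rightarrow> mm" where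
  "two_point a = step_mm {0, 2} two_dist (two_step a)"

text \<open>Normalized so that the light point 2 is at distance 1 and the pair 0, 1 at distance
  \<open>r\<close>; multiplying by \<open>1 / r\<close> moves the pair to distance 1 and the light
  point to \<open>1 / r\<close>. The path from 0 to 1 through 2 has length 2, whence the bound
  \<open>r \<le> 2\<close> required later.\<close>

definition three_dist :: "real \<Rightarrow> real \<Rightarrow> real \<Rightarrow> real" where
  "three_dist r x y = (if x = y then 0 else if x = 2 \<or> y = 2 then 1 else r)"

definition three_step :: "real \<Rightarrow> real \<Rightarrow> real" where
  "three_step a s = (if s < 1 / 2 then 0 else if s < 1 - a then 1 else 2)"

definition three_point :: "real \<Rightarrow> real \<Rightarrow> mm" where
  "three_point a r = step_mm {0, 1, 2} (three_dist r) (three_step a)"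

lemma two_step_vimage:
  assumes "0 < a" "a < 1"
  shows "two_step a -` {0} \<inter> {0..<1} = {0..<1 - a}" "two_step a -` {2} \<inter> {0..<1} = {1 - a..<1}"
  using assms by (auto simp: two_step_def split: if_splits)

lemma three_step_vimage:
  assumes "0 < a" "a < 1 / 2"
  shows "three_step a -` {0} \<inter> {0..<1} = {0..<1 / 2}" "three_step a -` {1} \<inter> {0..<1} = {1 / 2..<1 - a}"
    "three_step a -` {2} \<inter> {0..<1} = {1 - a..<1}"
  using assms by (auto simp: three_step_def split: if_splits)

lemma measurable_two_step:
  assumes "0 < a" "a < 1"
  shows "two_step a \<in> measurable LI (count_space {0, 2})"
proof (rule measurable_step)
  fix x :: real assume "x \<in> {0, 2}"
  then have "x = 0 \<or> x = 2" by blast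
  then show "two_step a -` {x} \<inter> {0..<1} \<in> sets borel"
    using two_step_vimage[OF assms] by (elim disjE) simp_all
qed (auto simp: two_step_def)

lemma measurable_three_step:
  assumes "0 < a" "a < 1 / 2"
  shows "three_step a \<in> measurable LI (count_space {0, 1, 2})"
proof (rule measurable_step)
  fix x :: real assume "x \<in> {0, 1, 2}"
  then have "x = 0 \<or> x = 1 \<or> x = 2" by blast
  then show "three_step a -` {x} \<inter> {0..<1} \<in> sets borel"
    using three_step_vimage[OF assms] by (elim disjE) simp_all
qed (auto simp: three_step_def)

lemma mm_space_two_point:
  assumes "0 < a" "a < 1"
  shows "mm_space (two_point a)"
  unfolding two_point_def
proof (rule mm_space_step_mm[OF _ _ measurable_two_step[OF assms]])
  show "Metric_space {0, 2} two_dist" by (rule Metric_space.intro) (auto simp: two_dist_def)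
  fix x :: real assume "x \<in> {0, 2}"
  then have "x = 0 \<or> x = 2" by blast
  then show "measure LI (two_step a -` {x} \<inter> {0..<1}) > 0"
    using two_step_vimage[OF assms] measure_LI_interval[of 0 "1 - a"] measure_LI_interval[of "1 - a" 1] assms
    by (elim disjE) simp_all
qed simp

lemma Metric_space_three_dist:
  assumes "0 < r" "r \<le> 2" "0 < t"
  shows "Metric_space S (\<lambda>x y. t * three_dist r x y)"
proof (rule Metric_space.intro)
  fix x y z :: real
  show "0 \<le> t * three_dist r x y" "t * three_dist r x y = t * three_dist r y x"
    "t * three_dist r x y = 0 \<longleftrightarrow> x = y"
    using assms by (auto simp: three_dist_def)
  have "three_dist r x z \<le> three_dist r x y + three_dist r y z"
    using assms by (auto simp: three_dist_def)
  then show "t * three_dist r x z \<le> t * three_dist r x y + t * three_dist r y z"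
    using assms(3) by (simp flip: distrib_left)
qed

lemma mm_space_scaled_three_point:
  assumes a: "0 < a" "a < 1 / 2" and r: "0 < r" "r \<le> 2" "0 < t"
  shows "mm_space (mm_scale t (three_point a r))"
  unfolding three_point_def scale_step_mm
proof (rule mm_space_step_mm[OF _ Metric_space_three_dist[OF r] measurable_three_step[OF a]])
  fix x :: real assume "x \<in> {0, 1, 2}"
  then have "x = 0 \<or> x = 1 \<or> x = 2" by blast
  then show "measure LI (three_step a -` {x} \<inter> {0..<1}) > 0"
    using three_step_vimage[OF a] measure_LI_interval[of 0 "1 / 2"] measure_LI_interval[of "1 / 2" "1 - a"]
      measure_LI_interval[of "1 - a" 1] a
    by (elim disjE) simp_all
qed simp

text \<open>Discarding the light atom, which occupies \<open>{1 - a..<1}\<close>, costs measure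
  \<open>a\<close>. On the rest the step functions match 0 with 0 and 2 with 1, both pairs at
  distance 1, so the discrepancy is 0.\<close>

lemma box_dist_two_three:
  assumes a: "0 < a" "a < 1 / 2" and r: "0 < r"
  shows "box_dist (two_point (1 / 2)) (mm_scale (1 / r) (three_point a r)) \<le> a"
proof (rule box_dist_le)
  have "parameter (two_point (1 / 2)) (two_step (1 / 2))"
    unfolding two_point_def by (intro parameter_step_mm measurable_two_step) simp_all
  moreover have "parameter (mm_scale (1 / r) (three_point a r)) (three_step a)"
    unfolding three_point_def scale_step_mm by (intro parameter_step_mm measurable_three_step[OF a])
  moreover have "{0..<1 - a} \<in> sets LI" using a by (auto simp: sets_LI)
  moreover have "measure LI {0..<1 - a} = 1 - a" using measure_LI_interval[of 0 "1 - a"] a by simp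
  moreover have "\<bar>mm_dist (two_point (1 / 2)) (two_step (1 / 2) s) (two_step (1 / 2) t)
      - mm_dist (mm_scale (1 / r) (three_point a r)) (three_step a s) (three_step a t)\<bar> \<le> a"
    if "s \<in> {0..<1 - a}" "t \<in> {0..<1 - a}" for s t
    using that a r
    by (auto simp: two_point_def three_point_def two_dist_def three_dist_def two_step_def three_step_def)
  ultimately show "box_witness (two_point (1 / 2)) (mm_scale (1 / r) (three_point a r)) a
      (two_step (1 / 2)) (three_step a) {0..<1 - a}"
    using a(1) unfolding box_witness_def by simp
qed

text \<open>The step functions are compared on the whole interval. The only discrepancy is that the
  pair 0, 1 at distance \<open>r\<close> is collapsed to the single point 0.\<close>

lemma box_dist_two_three_small:
  assumes a: "0 < a" "a < 1 / 2" and r: "0 < r"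
  shows "box_dist (two_point a) (three_point a r) \<le> r"
proof (rule box_dist_le)
  have "parameter (two_point a) (two_step a)"
    unfolding two_point_def using a by (intro parameter_step_mm measurable_two_step) simp_all
  moreover have "parameter (three_point a r) (three_step a)"
    unfolding three_point_def by (intro parameter_step_mm measurable_three_step[OF a])
  moreover have "{0..<1} \<in> sets LI" by (simp add: sets_LI)
  moreover have "measure LI {0..<1} = 1" using measure_LI_interval[of 0 1] by simp
  moreover have "\<bar>mm_dist (two_point a) (two_step a s) (two_step a t)
      - mm_dist (three_point a r) (three_step a s) (three_step a t)\<bar> \<le> r"
    if "s \<in> {0..<1}" "t \<in> {0..<1}" for s t
    using that a r
    by (auto simp: two_point_def three_point_def two_dist_def three_dist_def two_step_def three_step_def)
  ultimately show "box_witness (two_point a) (three_point a r) r (two_step a) (three_step a) {0..<1}"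
    using r unfolding box_witness_def by simp
qed

lemma measure_two_point:
  assumes "0 < a" "a < 1" "x \<in> {0, 2}"
  shows "measure (mm_meas (two_point a)) {x} = (if x = 0 then 1 - a else a)"
proof -
  have "measure (mm_meas (two_point a)) {x} = measure LI (two_step a -` {x} \<inter> {0..<1})"
    unfolding two_point_def using measure_distr[OF measurable_two_step[OF assms(1,2)], of "{x}"] assms(3) by simp
  moreover have "x = 0 \<or> x = 2" using assms(3) by blast
  ultimately show ?thesis
    using two_step_vimage[OF assms(1,2)] measure_LI_interval[of 0 "1 - a"] measure_LI_interval[of "1 - a" 1] assms(1,2)
    by (elim disjE) simp_all
qed

lemma separates_two_point_half: "separates (two_point (1 / 2))"
  unfolding separates_def
proof (intro bexI exI conjI)
  have set: "mm_set (two_point (1 / 2)) = {0, 2}" by (simp add: two_point_def)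
  \<comment> \<open>Halving is needed because the points are the reals 0 and 2 while their distance
    is 1; the values 0 and 1 then serve as thresholds.\<close>
  show "(\<lambda>x. x / 2) \<in> lip1 (two_point (1 / 2))"
    by (auto simp: lip1_def two_point_def two_dist_def)
  show "(0 :: real) < 1" by simp
  have "{x \<in> {0, 2 :: real}. x / 2 \<le> 0} = {0}" "{x \<in> {0, 2 :: real}. 1 \<le> x / 2} = {2}" by auto
  then show "measure (mm_meas (two_point (1 / 2))) {x \<in> mm_set (two_point (1 / 2)). x / 2 \<le> 0} > 1 / 4"
    "measure (mm_meas (two_point (1 / 2))) {x \<in> mm_set (two_point (1 / 2)). 1 \<le> x / 2} > 1 / 4"
    unfolding set using measure_two_point[of "1 / 2" 0] measure_two_point[of "1 / 2" 2] by simp_all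
qed

text \<open>As \<open>c < c'\<close>, the heavy point 0 lies in at most one of the two level sets.
  The other one is contained in \<open>{2}\<close> and has mass at most \<open>a\<close>.\<close>

lemma not_separates_two_point:
  assumes a: "0 < a" "a \<le> 1 / 4"
  shows "\<not> separates (two_point a)"
proof
  assume "separates (two_point a)"
  then obtain f :: "real \<Rightarrow> real" and c c' where
    f: "c < c'" "measure (mm_meas (two_point a)) {x \<in> mm_set (two_point a). f x \<le> c} > 1 / 4"
    "measure (mm_meas (two_point a)) {x \<in> mm_set (two_point a). c' \<le> f x} > 1 / 4"
    unfolding separates_def by blast
  have set: "mm_set (two_point a) = {0, 2}" by (simp add: two_point_def)
  interpret P: prob_space "mm_meas (two_point a)"
    using mm_space_two_point[of a] a by (simp add: mm_space_def)
  have small: "measure (mm_meas (two_point a)) A \<le> 1 / 4" if "A \<subseteq> {0, 2}" "0 \<notin> A" for A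
  proof -
    have "A \<subseteq> {2}" using that by blast
    then have "measure (mm_meas (two_point a)) A \<le> measure (mm_meas (two_point a)) {2}"
      by (intro P.finite_measure_mono) (simp_all add: two_point_def)
    then show ?thesis using measure_two_point[of a 2] a by simp
  qed
  have "0 \<notin> {x \<in> mm_set (two_point a). f x \<le> c} \<or> 0 \<notin> {x \<in> mm_set (two_point a). c' \<le> f x}"
    using f(1) by auto
  moreover have "{x \<in> mm_set (two_point a). f x \<le> c} \<subseteq> {0, 2}" "{x \<in> mm_set (two_point a). c' \<le> f x} \<subseteq> {0, 2}"
    unfolding set by blast+
  ultimately show False
    using small[of "{x \<in> mm_set (two_point a). f x \<le> c}"]
      small[of "{x \<in> mm_set (two_point a). c' \<le> f x}"] f(2,3) by linarith
qed

lemma mm_class_in_XX_star: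
  assumes X: "mm_space X" and xy: "x \<in> mm_set X" "y \<in> mm_set X" "x \<noteq> y"
  shows "mm_class X \<in> XX_star"
proof -
  have "mm_class X \<noteq> star"
  proof
    assume "mm_class X = star"
    then have "mm_iso mm_point X" using mm_class_self[OF X] by (simp add: star_def mm_class_def)
    then obtain f where "bij_betw f (mm_set mm_point) (mm_set X)" unfolding mm_iso_def by blast
    then have "mm_set X = {f 0}" by (simp add: bij_betw_def mm_point_def mm_set_def)
    then show False using xy by simp
  qed
  then show ?thesis using mm_class_in_XX[OF X] by (simp add: XX_star_def)
qed

section \<open>The quotient is not regular\<close>

context mm_distance
begin

lemma topspace_XX_star: "topspace (subtopology (XX_top \<delta>) XX_star) = XX_star"
  by (auto simp: XX_top_def XX_star_def)

lemma openin_Sigma: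
  "openin (Sigma_top \<delta>) U \<longleftrightarrow> U \<subseteq> orbit ` XX_star \<and> openin (subtopology (XX_top \<delta>) XX_star) {A \<in> XX_star. orbit A \<in> U}"
  unfolding Sigma_top_def openin_quotient_topology topspace_XX_star ..

text \<open>The neighbourhood is given in the box distance whatever \<open>\<delta>\<close> is,
  since a box ball lies inside the \<open>\<delta>\<close> ball of the same radius. The finite
  examples can therefore be fed in directly.\<close>

lemma ball_in_open_Sigma:
  assumes U: "openin (Sigma_top \<delta>) U" and X: "mm_space X" "mm_class X \<in> XX_star" "orbit (mm_class X) \<in> U"
  shows "\<exists>e>0. \<forall>Y. mm_space Y \<longrightarrow> mm_class Y \<in> XX_star \<longrightarrow> box_dist X Y < e \<longrightarrow> orbit (mm_class Y) \<in> U"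
proof -
  obtain O' where O': "openin (XX_top \<delta>) O'" "{A \<in> XX_star. orbit A \<in> U} = O' \<inter> XX_star"
    using U unfolding openin_Sigma openin_subtopology by blast
  have "mm_class X \<in> O'" using O'(2) X(2,3) by blast
  then obtain e where e: "e > 0" "{B \<in> XX. \<delta> (mm_rep (mm_class X)) (mm_rep B) < e} \<subseteq> O'"
    using O'(1) unfolding XX_top_def openin_dist_topology by blast
  have "orbit (mm_class Y) \<in> U" if Y: "mm_space Y" "mm_class Y \<in> XX_star" "box_dist X Y < e" for Y
  proof -
    have "\<delta> (mm_rep (mm_class X)) (mm_rep (mm_class Y)) < e"
      using rep_le[OF X(1) Y(1)] Y(3) by linarith
    then have "mm_class Y \<in> O'" using e(2) mm_class_in_XX[OF Y(1)] by blast
    then show ?thesis using O'(2) Y(2) by blast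
  qed
  with e(1) show ?thesis by blast
qed

text \<open>The set of separating classes is a union of orbits, so it is the full preimage of its
  image in the quotient. It is open because a \<open>\<delta>\<close> ball lies inside the
  \<open>conc\<close> ball of the same radius.\<close>

lemma openin_separates_orbits:
  "openin (Sigma_top \<delta>) (orbit ` {A \<in> XX_star. separates (mm_rep A)})"
proof -
  let ?W = "{A \<in> XX_star. separates (mm_rep A)}"
  have sub: "XX_star \<subseteq> XX" by (auto simp: XX_star_def)
  have "{A \<in> XX_star. orbit A \<in> orbit ` ?W} = {A \<in> XX. separates (mm_rep A)} \<inter> XX_star"
  proof (intro equalityI subsetI)
    fix A assume "A \<in> {A \<in> XX_star. orbit A \<in> orbit ` ?W}"
    then obtain B where "A \<in> XX_star" "B \<in> ?W" "orbit A = orbit B" by blast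
    then show "A \<in> {A \<in> XX. separates (mm_rep A)} \<inter> XX_star"
      using separates_orbit[of A B] sub by blast
  qed (use sub in blast)
  moreover have "openin (XX_top \<delta>) {A \<in> XX. separates (mm_rep A)}"
    unfolding XX_top_def openin_dist_topology
  proof (intro conjI ballI)
    fix A assume A: "A \<in> {A \<in> XX. separates (mm_rep A)}"
    then have "mm_space (mm_rep A)" "separates (mm_rep A)" using mm_space_rep by simp_all
    from separates_conc_open[OF this] obtain e where e: "e > 0"
      "\<And>Y. mm_space Y \<Longrightarrow> conc (mm_rep A) Y < e \<Longrightarrow> separates Y" by blast
    have "separates (mm_rep B)" if B: "B \<in> XX" "\<delta> (mm_rep A) (mm_rep B) < e" for B
    proof (rule e(2)[OF mm_space_rep[OF B(1)]])
      show "conc (mm_rep A) (mm_rep B) < e"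
        using conc_le_dist[OF mm_space_rep mm_space_rep, of A B] A B by simp
    qed
    then show "\<exists>e>0. {B \<in> XX. \<delta> (mm_rep A) (mm_rep B) < e} \<subseteq> {A \<in> XX. separates (mm_rep A)}"
      using e(1) by blast
  qed blast
  ultimately have "openin (subtopology (XX_top \<delta>) XX_star) {A \<in> XX_star. orbit A \<in> orbit ` ?W}"
    unfolding openin_subtopology by blast
  then show ?thesis unfolding openin_Sigma by blast
qed

text \<open>The space \<open>three_point a r\<close> is close to \<open>two_point a\<close> for small \<open>r\<close>, while its multiple by \<open>1 / r\<close>
  is close to \<open>two_point (1 / 2)\<close> for small \<open>a\<close>. Hence every neighbourhood of the orbit of
  \<open>two_point (1 / 2)\<close> has the orbit of \<open>two_point a\<close> in its closure when \<open>a\<close> is small.\<close>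
lemma Sigma_not_regular: "\<not> regular_space (Sigma_top \<delta>)"
proof
  assume reg: "regular_space (Sigma_top \<delta>)"
  define W where "W = orbit ` {A \<in> XX_star. separates (mm_rep A)}"
  define C where "C = topspace (Sigma_top \<delta>) - W"
  have W: "openin (Sigma_top \<delta>) W" unfolding W_def by (rule openin_separates_orbits)
  have top: "topspace (Sigma_top \<delta>) = orbit ` XX_star"
    unfolding Sigma_top_def topspace_quotient_topology topspace_XX_star ..
  have two: "mm_space (two_point a)" "mm_class (two_point a) \<in> XX_star"
    "space (mm_meas (two_point a)) = mm_set (two_point a)" if "0 < a" "a < 1" for a
  proof -
    show 1: "mm_space (two_point a)" using that by (rule mm_space_two_point)
    show "mm_class (two_point a) \<in> XX_star"
      by (rule mm_class_in_XX_star[OF 1, of 0 2]) (simp_all add: two_point_def)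
    show "space (mm_meas (two_point a)) = mm_set (two_point a)" by (simp add: two_point_def)
  qed
  have sep_rep: "separates (mm_rep (mm_class (two_point a))) \<longleftrightarrow> separates (two_point a)"
    if "0 < a" "a < 1" for a
    using separates_iso[OF mm_rep_class(1)[OF two(1)[OF that]] two(3)[OF that] mm_rep_class(2)[OF two(1)[OF that]]]
    by simp
  have half: "0 < (1 / 2 :: real)" "1 / 2 < (1 :: real)" by simp_all
  have "orbit (mm_class (two_point (1 / 2))) \<in> W"
    unfolding W_def using two(2)[OF half] sep_rep[OF half] separates_two_point_half by blast
  then have "orbit (mm_class (two_point (1 / 2))) \<in> topspace (Sigma_top \<delta>) - C"
    using openin_subset[OF W] unfolding C_def by blast
  moreover have "closedin (Sigma_top \<delta>) C" unfolding C_def using W by blast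
  ultimately obtain U V where UV: "openin (Sigma_top \<delta>) U" "openin (Sigma_top \<delta>) V"
    "orbit (mm_class (two_point (1 / 2))) \<in> U" "C \<subseteq> V" "disjnt U V"
    using reg unfolding regular_space_def by metis
  obtain e where e: "e > 0" "\<And>Y. mm_space Y \<Longrightarrow> mm_class Y \<in> XX_star \<Longrightarrow> box_dist (two_point (1 / 2)) Y < e
      \<Longrightarrow> orbit (mm_class Y) \<in> U"
    using ball_in_open_Sigma[OF UV(1) two(1,2)[OF half] UV(3)] by blast
  \<comment> \<open>\<open>a < e\<close> brings the scaled three-point space into the ball that maps
    into \<open>U\<close>; \<open>a \<le> 1 / 4\<close> keeps \<open>two_point a\<close> from
    separating, so that its orbit lies in \<open>C\<close>.\<close>
  define a where "a = min (e / 2) (1 / 4)"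
  have a: "0 < a" "a \<le> 1 / 4" "a < e" "a < 1" "a < 1 / 2" using e(1) by (auto simp: a_def)
  have "orbit (mm_class (two_point a)) \<notin> W"
  proof
    assume "orbit (mm_class (two_point a)) \<in> W"
    then obtain B where B: "B \<in> XX_star" "separates (mm_rep B)" "orbit (mm_class (two_point a)) = orbit B"
      unfolding W_def by blast
    have "B \<in> XX" using B(1) by (simp add: XX_star_def)
    from separates_orbit[OF mm_class_in_XX[OF two(1)[OF a(1,4)]] this B(3,2)]
    show False using sep_rep[OF a(1,4)] not_separates_two_point[OF a(1,2)] by simp
  qed
  then have V: "orbit (mm_class (two_point a)) \<in> V"
    using UV(4) two(2)[OF a(1,4)] unfolding C_def top by blast
  obtain e' where e': "e' > 0" "\<And>Y. mm_space Y \<Longrightarrow> mm_class Y \<in> XX_star \<Longrightarrow> box_dist (two_point a) Y < e'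
      \<Longrightarrow> orbit (mm_class Y) \<in> V"
    using ball_in_open_Sigma[OF UV(2) two(1)[OF a(1,4)] two(2)[OF a(1,4)] V] by blast
  \<comment> \<open>The radius \<open>e'\<close> belongs to the centre \<open>two_point a\<close>
    and so depends on \<open>a\<close>; this is why \<open>r\<close> is chosen last. The cap 1
    guarantees the triangle inequality of the three-point space.\<close>
  define r where "r = min (e' / 2) 1"
  have r: "0 < r" "r \<le> 2" "r < e'" "1 / r > 0" using e'(1) by (auto simp: r_def)
  have Z: "mm_space (three_point a r)"
    using mm_space_scaled_three_point[OF a(1,5) r(1,2) zero_less_one] by (simp add: mm_scale_1)
  note Z' = mm_space_scaled_three_point[OF a(1,5) r(1,2,4)]
  have star: "mm_class (three_point a r) \<in> XX_star" "mm_class (mm_scale (1 / r) (three_point a r)) \<in> XX_star"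
    by (rule mm_class_in_XX_star[OF Z, of 0 2], simp_all add: three_point_def)
      (rule mm_class_in_XX_star[OF Z'[unfolded three_point_def], of 0 2], simp_all)
  have "orbit (mm_class (three_point a r)) \<in> V"
    using e'(2)[OF Z star(1)] box_dist_two_three_small[OF a(1,5) r(1)] r(3) by linarith
  moreover have "orbit (mm_class (mm_scale (1 / r) (three_point a r))) \<in> U"
    using e(2)[OF Z' star(2)] box_dist_two_three[OF a(1,5) r(1)] a(3) by linarith
  \<comment> \<open>The two approximations concern multiples of one space, which
    \<open>\<Sigma>\<close> identifies, so a single point lies in both \<open>U\<close> and
    \<open>V\<close>.\<close>
  moreover have "orbit (mm_class (mm_scale (1 / r) (three_point a r))) = orbit (mm_class (three_point a r))"
    by (rule orbit_scale[OF Z Z' r(4)])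
  ultimately show False using UV(5) unfolding disjnt_def by (metis IntI empty_iff)
qed

lemma not_product: "\<not> subtopology (XX_top \<delta>) XX_star homeomorphic_space
    prod_topology (subtopology euclideanreal {0<..}) (Sigma_top \<delta>)"
proof
  assume "subtopology (XX_top \<delta>) XX_star homeomorphic_space
    prod_topology (subtopology euclideanreal {0<..}) (Sigma_top \<delta>)"
  then have "regular_space (prod_topology (subtopology euclideanreal {0<..}) (Sigma_top \<delta>))"
    using homeomorphic_regular_space regular_space_subtopology[OF regular_XX] by blast
  moreover have "topspace (subtopology euclideanreal {0<..}) \<noteq> {}" by (simp add: gt_ex)
  ultimately show False using regular_space_prod_factor Sigma_not_regular by blast
qed

lemma not_cone: "\<not> XX_top \<delta> homeomorphic_space cone_top (Sigma_top \<delta>)"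
  using homeomorphic_regular_space regular_XX regular_space_cone_base Sigma_not_regular by blast

end

theorem theorem1p1:
  shows "\<forall>\<delta>\<in>{box_dist, conc}.
           \<not> (subtopology (XX_top \<delta>) XX_star homeomorphic_space
                 prod_topology (subtopology euclideanreal {0<..}) (Sigma_top \<delta>))
         \<and> \<not> (XX_top \<delta> homeomorphic_space cone_top (Sigma_top \<delta>))"
  using mm_distance.not_product[OF mm_distance_box_dist] mm_distance.not_cone[OF mm_distance_box_dist]
    mm_distance.not_product[OF mm_distance_conc] mm_distance.not_cone[OF mm_distance_conc]
  by simp

end
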